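(* Let $\mathbb{X}$ be a finite quantum set, let $n\in\mathbb{N}$ and let $\mathcal{G}_i=(\mathbb{X},A_i)$, $i=1,\dots,n$, be regular quantum graphs without loops on $\mathbb{X}$ (not necessarily undirected). Then there exists an undirected quantum graph $\mathcal{G}=(\mathbb{X}',A')$ such that $\operatorname{Qut}(\mathcal{G})=\bigcap_{i=1}^n\operatorname{Qut}(\mathcal{G}_i)$.
   Context: A finite quantum set $\mathbb{X}$ is a finite-dimensional C*-algebra $C(\mathbb{X})$ with its unique tracial positive functional $\psi$ such that, for $\langle x,y\rangle=\psi(x^*y)$ on $\ell^2(\mathbb{X}):=C(\mathbb{X})$, the multiplication $m$ satisfies $mm^*=\mathrm{id}$; $\eta$ denotes the unit of $C(\mathbb{X})$. For linear maps on $\ell^2(\mathbb{X})$: $A\bullet B=m(A\otimes B)m^*$, $\bar Af=(A(f^* ))^*$. A (directed) quantum graph is $(\mathbb{X},A)$ with $A\bullet A=A=\bar A$; undirected if $A=A^*$; no loops if $A\bullet I=0$; $d$-regular if $A\eta=A^*\eta=d\eta$, regular if $d$-regular for some $d$. $\operatorname{Qut}(\mathbb{X},A)$ is the compact matrix quantum group whose Hopf $*$-algebra is the universal $*$-algebra generated by the entries $u_{ij}$ of a matrix $U$ (in an orthonormal basis of $\ell^2(\mathbb{X})$) subject to $U$ unitary, $m(U\otimes U)=Um$, $U\eta=\eta$, $UA=AU$. The intersection of compact matrix quantum groups with fundamental representations of the same size is given by the universal $*$-algebra generated by $u_{ij}$ subject to the relations of all of them. Equality is understood as isomorphism of compact quantum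 groups. *)

theory Defs
  imports Complex_Main "HOL-Library.Function_Algebras"
begin

text \<open>An element of the free *-algebra on generators 'g is a finitely supported
  complex function on words in the letters g (False) and g* (True).\<close>

type_synonym 'g fpoly = "('g \<times> bool) list \<Rightarrow> complex"

definition wrd :: "('g \<times> bool) list \<Rightarrow> 'g fpoly" where
  "wrd u = (\<lambda>w. if w = u then 1 else 0)"

definition pone :: "'g fpoly" where "pone = wrd []"

definition gen :: "'g \<Rightarrow> 'g fpoly" where "gen g = wrd [(g, False)]"

definition sgen :: "'g \<Rightarrow> 'g fpoly" where "sgen g = wrd [(g, True)]"

definition psc :: "complex \<Rightarrow> 'g fpoly \<Rightarrow> 'g fpoly" where
  "psc c p = (\<lambda>w. c * p w)"

definition pmult :: "'g fpoly \<Rightarrow> 'g fpoly \<Rightarrow> 'g fpoly" where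
  "pmult p q = (\<lambda>w. \<Sum>k\<le>length w. p (take k w) * q (drop k w))"

definition pstar :: "'g fpoly \<Rightarrow> 'g fpoly" where
  "pstar p = (\<lambda>w. cnj (p (rev (map (\<lambda>(g, b). (g, \<not> b)) w))))"

definition fsupp :: "'g fpoly \<Rightarrow> bool" where
  "fsupp p \<longleftrightarrow> finite {w. p w \<noteq> 0}"

fun weval :: "('g \<Rightarrow> 'h fpoly) \<Rightarrow> ('g \<times> bool) list \<Rightarrow> 'h fpoly" where
  "weval f [] = pone"
| "weval f ((g, b) # w) = pmult (if b then pstar (f g) else f g) (weval f w)"

definition peval :: "('g \<Rightarrow> 'h fpoly) \<Rightarrow> 'g fpoly \<Rightarrow> 'h fpoly" where
  "peval f p = (\<Sum>w\<in>{w. p w \<noteq> 0}. psc (p w) (weval f w))"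

inductive_set ideal_of :: "'g fpoly set \<Rightarrow> 'g fpoly set" for R where
  zero: "0 \<in> ideal_of R"
| gen: "r \<in> R \<Longrightarrow> psc c (pmult (pmult (wrd u) r) (wrd v)) \<in> ideal_of R"
| add: "x \<in> ideal_of R \<Longrightarrow> y \<in> ideal_of R \<Longrightarrow> x + y \<in> ideal_of R"

text \<open>The *-ideal generated by R; the universal *-algebra with relations R is
  the free *-algebra modulo this ideal.\<close>

definition star_ideal :: "'g fpoly set \<Rightarrow> 'g fpoly set" where
  "star_ideal R = ideal_of (R \<union> pstar ` R)"

text \<open>Presentation of the algebraic tensor product B \<otimes> B of the universal
  *-algebra B with relations R with itself.\<close>

definition tens_rels :: "'g fpoly set \<Rightarrow> ('g + 'g) fpoly set" where
  "tens_rels R =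
     peval (\<lambda>g. gen (Inl g)) ` R \<union> peval (\<lambda>g. gen (Inr g)) ` R \<union>
     {pmult (wrd [(Inl g, b)]) (wrd [(Inr h, c)]) - pmult (wrd [(Inr h, c)]) (wrd [(Inl g, b)])
        | g h b c. True}"

definition comult :: "'j set \<Rightarrow> ('j \<times> 'j) \<Rightarrow> ('j \<times> 'j + 'j \<times> 'j) fpoly" where
  "comult J x = (case x of (a, b) \<Rightarrow>
      (\<Sum>k\<in>J. pmult (gen (Inl (a, k))) (gen (Inr (k, b)))))"

text \<open>Isomorphism of compact matrix quantum groups given by universal *-algebras
  with generators u_ij (i,j in I) resp. (J), relations R resp. S:
  a *-isomorphism of the Hopf *-algebras intertwining the comultiplications.\<close>

definition cmqg_iso ::
  "'i set \<Rightarrow> ('i \<times> 'i) fpoly set \<Rightarrow> 'j set \<Rightarrow> ('j \<times> 'j) fpoly set \<Rightarrow> bool" where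
  "cmqg_iso I R J S \<longleftrightarrow>
     (\<exists>(p :: 'i \<times> 'i \<Rightarrow> ('j \<times> 'j) fpoly) (q :: 'j \<times> 'j \<Rightarrow> ('i \<times> 'i) fpoly).
        (\<forall>x. fsupp (p x)) \<and> (\<forall>y. fsupp (q y)) \<and>
        (\<forall>r\<in>R. peval p r \<in> star_ideal S) \<and>
        (\<forall>s\<in>S. peval q s \<in> star_ideal R) \<and>
        (\<forall>x\<in>I \<times> I. peval q (p x) - gen x \<in> star_ideal R) \<and>
        (\<forall>y\<in>J \<times> J. peval p (q y) - gen y \<in> star_ideal S) \<and>
        (\<forall>i\<in>I. \<forall>j\<in>I.
           peval (comult J) (p (i, j))
           - (\<Sum>k\<in>I. pmult (peval (\<lambda>g. gen (Inl g)) (p (i, k)))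
                            (peval (\<lambda>g. gen (Inr g)) (p (k, j))))
           \<in> star_ideal (tens_rels S)))"

text \<open>A finite quantum set is C(X) = M_{n_1} \<oplus> ... \<oplus> M_{n_r}, encoded by the list
  ns = [n_1,...,n_r]; its unique tracial functional with m m^* = id is
  psi = \<oplus> n_k Tr. We use the orthonormal basis f_(k,a,b) = E^(k)_ab / sqrt n_k
  of l^2(X); linear maps on l^2(X) are matrices in this basis.\<close>

type_synonym ix = "nat \<times> nat \<times> nat"
type_synonym mat = "ix \<Rightarrow> ix \<Rightarrow> complex"

definition idx :: "nat list \<Rightarrow> ix set" where
  "idx ns = {(k, a, b). k < length ns \<and> a < ns ! k \<and> b < ns ! k}"

definition qset :: "nat list \<Rightarrow> bool" where
  "qset ns \<longleftrightarrow> ns \<noteq> [] \<and> (\<forall>n\<in>set ns. 0 < n)"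

definition sqn :: "nat list \<Rightarrow> nat \<Rightarrow> complex" where
  "sqn ns k = complex_of_real (sqrt (real (ns ! k)))"

text \<open>Structure constants of m: m(f_i \<otimes> f_j) = sum_l mc l i j f_l.\<close>

definition mc :: "nat list \<Rightarrow> ix \<Rightarrow> ix \<Rightarrow> ix \<Rightarrow> complex" where
  "mc ns l i j = (case (l, i, j) of ((k, a, c), (k1, a1, b1), (k2, b2, c2)) \<Rightarrow>
      if k1 = k \<and> k2 = k \<and> a1 = a \<and> b1 = b2 \<and> c2 = c then 1 / sqn ns k else 0)"

definition eta :: "nat list \<Rightarrow> ix \<Rightarrow> complex" where
  "eta ns l = (case l of (k, a, b) \<Rightarrow> if a = b then sqn ns k else 0)"

text \<open>A \<bullet> B = m (A \<otimes> B) m^*.\<close>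

definition bul :: "nat list \<Rightarrow> mat \<Rightarrow> mat \<Rightarrow> mat" where
  "bul ns A B = (\<lambda>l l'. \<Sum>i\<in>idx ns. \<Sum>j\<in>idx ns. \<Sum>i'\<in>idx ns. \<Sum>j'\<in>idx ns.
       mc ns l i j * A i i' * B j j' * cnj (mc ns l' i' j'))"

definition invol :: "ix \<Rightarrow> ix" where
  "invol x = (case x of (k, a, b) \<Rightarrow> (k, b, a))"

text \<open>bar A f = (A (f^*))^*.\<close>

definition mbar :: "mat \<Rightarrow> mat" where
  "mbar A = (\<lambda>i j. cnj (A (invol i) (invol j)))"

definition madj :: "mat \<Rightarrow> mat" where
  "madj A = (\<lambda>i j. cnj (A j i))"

definition mid :: "mat" where
  "mid = (\<lambda>i j. if i = j then 1 else 0)"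

definition meq :: "nat list \<Rightarrow> mat \<Rightarrow> mat \<Rightarrow> bool" where
  "meq ns A B \<longleftrightarrow> (\<forall>i\<in>idx ns. \<forall>j\<in>idx ns. A i j = B i j)"

definition mapply :: "nat list \<Rightarrow> mat \<Rightarrow> (ix \<Rightarrow> complex) \<Rightarrow> ix \<Rightarrow> complex" where
  "mapply ns A v = (\<lambda>i. \<Sum>j\<in>idx ns. A i j * v j)"

definition qgraph :: "nat list \<Rightarrow> mat \<Rightarrow> bool" where
  "qgraph ns A \<longleftrightarrow> meq ns (bul ns A A) A \<and> meq ns (mbar A) A"

definition undirected :: "nat list \<Rightarrow> mat \<Rightarrow> bool" where
  "undirected ns A \<longleftrightarrow> meq ns (madj A) A"

definition no_loops :: "nat list \<Rightarrow> mat \<Rightarrow> bool" where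
  "no_loops ns A \<longleftrightarrow> meq ns (bul ns A mid) (\<lambda>_ _. 0)"

definition d_regular :: "nat list \<Rightarrow> mat \<Rightarrow> complex \<Rightarrow> bool" where
  "d_regular ns A d \<longleftrightarrow>
     (\<forall>i\<in>idx ns. mapply ns A (eta ns) i = d * eta ns i) \<and>
     (\<forall>i\<in>idx ns. mapply ns (madj A) (eta ns) i = d * eta ns i)"

definition regular :: "nat list \<Rightarrow> mat \<Rightarrow> bool" where
  "regular ns A \<longleftrightarrow> (\<exists>d. d_regular ns A d)"

text \<open>Relations of Qut(X): U unitary, m(U \<otimes> U) = U m, U eta = eta (u_ij with
  i,j outside the index set are set to 0).\<close>

definition qut_base :: "nat list \<Rightarrow> (ix \<times> ix) fpoly set" where
  "qut_base ns =
     {gen x | x. x \<notin> idx ns \<times> idx ns}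
   \<union> {(\<Sum>k\<in>idx ns. pmult (gen (i, k)) (sgen (j, k))) - (if i = j then pone else 0)
       | i j. i \<in> idx ns \<and> j \<in> idx ns}
   \<union> {(\<Sum>k\<in>idx ns. pmult (sgen (k, i)) (gen (k, j))) - (if i = j then pone else 0)
       | i j. i \<in> idx ns \<and> j \<in> idx ns}
   \<union> {(\<Sum>p\<in>idx ns. \<Sum>q\<in>idx ns. psc (mc ns l p q) (pmult (gen (p, i)) (gen (q, j))))
        - (\<Sum>r\<in>idx ns. psc (mc ns r i j) (gen (l, r)))
       | l i j. l \<in> idx ns \<and> i \<in> idx ns \<and> j \<in> idx ns}
   \<union> {(\<Sum>j\<in>idx ns. psc (eta ns j) (gen (i, j))) - psc (eta ns i) pone | i. i \<in> idx ns}"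

definition qut_comm :: "nat list \<Rightarrow> mat \<Rightarrow> (ix \<times> ix) fpoly set" where
  "qut_comm ns A =
     {(\<Sum>k\<in>idx ns. psc (A k j) (gen (i, k))) - (\<Sum>k\<in>idx ns. psc (A i k) (gen (k, j)))
       | i j. i \<in> idx ns \<and> j \<in> idx ns}"

text \<open>Relations of the intersection of Qut(X, A) for A in a set of adjacency matrices
  (for a single A this is Qut(X, A)).\<close>

definition qut_rels :: "nat list \<Rightarrow> mat set \<Rightarrow> (ix \<times> ix) fpoly set" where
  "qut_rels ns As = qut_base ns \<union> (\<Union>A\<in>As. qut_comm ns A)"

end

theory Submission
  imports Defs
begin

text \<open>Take an odd number N = 2 n + 3 of copies of X and let A' be an N by N block matrix whose
  blocks are 0, I, the A_i and their adjoints. Even copies carry loops (diagonal block I) and form a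
  path with edges I; each odd copy c is joined to c + 1 by I; and A_i is placed
  between the odd copies 2 i + 1 and 2 i + 3. Modulo the relations of Qut(A'), the matrices
  commuting with the fundamental representation are closed under products, adjoints and the Schur
  product m (A \<otimes> B) m*. The Schur product of A' with I is the projection onto the even copies;
  copy 0 is the only even copy not attached to an odd one, so its projection commutes, and walking
  along the path yields all matrix units between the copies. Hence the fundamental
  representation is block diagonal with equal blocks, and its block commutes with every block
  of A', in particular with every A_i.\<close>

section \<open>The free star-algebra\<close>

text \<open>Equality means isomorphism, so the fundamental representation of Qut(A') may be larger
  than that of the intersection; this freedom permits passing to copies of X. The obstacle is that
  one matrix A' has to carry all the A_i and yet give each of them back through operations that
  preserve commutation. A loop is a mark that the Schur product with I can read, because that
  product retains only diagonal blocks, which here are 0 or I. Each A_i is kept off the diagonal,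
  facing its adjoint, so that even a directed A_i contributes a self-adjoint pair. The even path
  alone could be reversed; the edges from c to c + 1 break this symmetry by leaving copy 0 bare. The
  count 2 n + 3 follows: n + 1 odd copies offer n gaps, one for each A_i, and the even copies are
  their n + 1 successors together with copy 0. Conversely, if U commutes with all A_i, it commutes
  with their adjoints and with I, so a direct sum of equal copies of U satisfies the relations of
  Qut(A').\<close>

text \<open>The induction methods eta-expand elements of the free algebra; with the pointwise
  rules active the simplifier would then evaluate sums and differences under the binder.\<close>

lemmas fpoly_pointwise = plus_fun_apply zero_fun_apply minus_apply
declare fpoly_pointwise [simp del]

section \<open>Convolution product and scalars\<close>

lemma pmult_Nil [simp]: "pmult p q [] = p [] * q []"
  by (simp add: pmult_def)

text \<open>The cut before the first letter is split off; the other cuts form a product whose left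
  factor is \<open>p\<close> shifted by \<open>x\<close>. This recursion drives the inductions on
  words.\<close>

lemma pmult_Cons: "pmult p q (x # w) = p [] * q (x # w) + pmult (\<lambda>u. p (x # u)) q w"
  by (simp add: pmult_def sum.atMost_Suc_shift del: sum.atMost_Suc)

lemma pmult_add_left: "pmult (p + q) r = pmult p r + pmult q r"
  by (rule ext) (simp add: fpoly_pointwise pmult_def algebra_simps sum.distrib)

lemma pmult_add_right: "pmult r (p + q) = pmult r p + pmult r q"
  by (rule ext) (simp add: fpoly_pointwise pmult_def algebra_simps sum.distrib)

lemma pmult_diff_left: "pmult (p - q) r = pmult p r - pmult q r"
  by (rule ext) (simp add: fpoly_pointwise pmult_def algebra_simps sum_subtractf)

lemma pmult_diff_right: "pmult r (p - q) = pmult r p - pmult r q"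
  by (rule ext) (simp add: fpoly_pointwise pmult_def algebra_simps sum_subtractf)

lemma pmult_zero [simp]: "pmult 0 p = 0" "pmult p 0 = 0"
  by (rule ext, simp add: fpoly_pointwise pmult_def)+

lemma pmult_psc_left [simp]: "pmult (psc c p) q = psc c (pmult p q)"
  by (rule ext) (simp add: fpoly_pointwise pmult_def psc_def sum_distrib_left mult.assoc)

lemma pmult_psc_right [simp]: "pmult p (psc c q) = psc c (pmult p q)"
  by (rule ext) (simp add: fpoly_pointwise pmult_def psc_def sum_distrib_left mult_ac)

lemma pmult_sum_left: "pmult (sum f A) q = (\<Sum>x\<in>A. pmult (f x) q)"
  by (induction A rule: infinite_finite_induct) (simp_all add: pmult_add_left)

lemma pmult_sum_right: "pmult q (sum f A) = (\<Sum>x\<in>A. pmult q (f x))"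
  by (induction A rule: infinite_finite_induct) (simp_all add: pmult_add_right)

lemma pmult_sum_sum: "pmult (sum f A) (sum g B) = (\<Sum>x\<in>A. \<Sum>y\<in>B. pmult (f x) (g y))"
  by (simp only: pmult_sum_left) (simp only: pmult_sum_right)

lemma pmult_assoc: "pmult (pmult p q) r = pmult p (pmult q r)"
proof
  fix w show "pmult (pmult p q) r w = pmult p (pmult q r) w"
  proof (induction w arbitrary: p)
    case (Cons x w)
    \<comment> \<open>Shifting a product by a letter obeys a Leibniz-type rule and yields a new left
      factor, which is why \<open>p\<close> stays arbitrary in the induction.\<close>
    have "(\<lambda>u. pmult p q (x # u)) = psc (p []) (\<lambda>u. q (x # u)) + pmult (\<lambda>u. p (x # u)) q"
      by (rule ext) (simp add: fpoly_pointwise pmult_Cons psc_def)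
    then have "pmult (\<lambda>u. pmult p q (x # u)) r w
        = p [] * pmult (\<lambda>u. q (x # u)) r w + pmult (\<lambda>u. p (x # u)) (pmult q r) w"
      by (simp only: pmult_add_left pmult_psc_left Cons.IH plus_fun_apply) (simp add: psc_def)
    then show ?case
      by (simp add: pmult_Cons[of _ _ x w] algebra_simps)
  qed simp
qed

lemma psc_simps [simp]:
  "psc 0 p = 0" "psc 1 p = p" "psc c 0 = 0" "psc a (psc b p) = psc (a * b) p"
  by (auto simp: fpoly_pointwise psc_def fun_eq_iff)

lemma psc_add_right: "psc c (p + q) = psc c p + psc c q"
  by (auto simp: fpoly_pointwise psc_def fun_eq_iff algebra_simps)

lemma psc_add_left: "psc (a + b) p = psc a p + psc b p"
  by (auto simp: fpoly_pointwise psc_def fun_eq_iff algebra_simps)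

lemma psc_diff_right: "psc c (p - q) = psc c p - psc c q"
  by (auto simp: fpoly_pointwise psc_def fun_eq_iff algebra_simps)

lemma psc_diff_left: "psc (a - b) p = psc a p - psc b p"
  by (auto simp: fpoly_pointwise psc_def fun_eq_iff algebra_simps)

lemma psc_sum_right: "psc c (sum f A) = (\<Sum>x\<in>A. psc c (f x))"
  by (induction A rule: infinite_finite_induct) (simp_all add: psc_add_right)

lemma psc_sum_left: "psc (sum f A) p = (\<Sum>x\<in>A. psc (f x) p)"
  by (induction A rule: infinite_finite_induct) (simp_all add: psc_add_left)

lemma pmult_wrd [simp]: "pmult (wrd u) (wrd v) = wrd (u @ v)"
proof
  fix w show "pmult (wrd u) (wrd v) w = wrd (u @ v) w"
  proof (induction u arbitrary: w)
    case Nil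
    show ?case
    proof (cases w)
      case (Cons x w')
      have "pmult (\<lambda>u. wrd [] (x # u)) (wrd v) w' = (0 :: complex)"
        by (simp add: fpoly_pointwise pmult_def wrd_def)
      then show ?thesis using Cons by (simp add: pmult_Cons wrd_def)
    qed (simp add: wrd_def)
  next
    case (Cons x u)
    show ?case
    proof (cases w)
      case (Cons y w')
      have "(\<lambda>t. wrd (x # u) (y # t)) = (if x = y then wrd u else 0)"
        by (auto simp: fpoly_pointwise wrd_def fun_eq_iff)
      then show ?thesis using Cons Cons.IH
        by (simp add: fpoly_pointwise pmult_Cons wrd_def)
    qed (simp add: wrd_def)
  qed
qed

lemma pmult_pone [simp]: "pmult pone p = p" "pmult p pone = p"
proof -
  show "pmult pone p = p"
  proof
    have zero: "pmult (\<lambda>u. wrd [] (x # u)) p w = 0" for x w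
      by (simp add: pmult_def wrd_def)
    fix w show "pmult pone p w = p w"
      by (cases w) (auto simp: pmult_Cons pone_def zero, auto simp: wrd_def)
  qed
  show "pmult p pone = p"
  proof
    fix w show "pmult p pone w = p w"
      by (induction w arbitrary: p) (auto simp: pmult_Cons pone_def wrd_def)
  qed
qed

section \<open>The involution\<close>

lemma pstar_add: "pstar (p + q) = pstar p + pstar q"
  by (auto simp: fpoly_pointwise pstar_def fun_eq_iff)

lemma pstar_diff: "pstar (p - q) = pstar p - pstar q"
  by (auto simp: fpoly_pointwise pstar_def fun_eq_iff)

lemma pstar_psc [simp]: "pstar (psc c p) = psc (cnj c) (pstar p)"
  by (auto simp: fpoly_pointwise pstar_def psc_def fun_eq_iff)

lemma pstar_zero [simp]: "pstar 0 = 0"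
  by (auto simp: fpoly_pointwise pstar_def fun_eq_iff)

lemma pstar_sum: "pstar (sum f A) = (\<Sum>x\<in>A. pstar (f x))"
  by (induction A rule: infinite_finite_induct) (simp_all add: pstar_add)

definition wstar :: "('g \<times> bool) list \<Rightarrow> ('g \<times> bool) list" where
  "wstar w = rev (map (\<lambda>(g, b). (g, \<not> b)) w)"

lemma wstar_simps [simp]: "wstar (wstar w) = w" "wstar [] = []" "length (wstar w) = length w"
  "wstar (u @ v) = wstar v @ wstar u" "wstar ((g, b) # w) = wstar w @ [(g, \<not> b)]"
  by (auto simp: wstar_def rev_map case_prod_beta o_def)

lemma wstar_eq_iff: "wstar w = u \<longleftrightarrow> w = wstar u"
  by (metis wstar_simps(1))

lemma pstar_alt: "pstar p w = cnj (p (wstar w))"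
  by (simp add: pstar_def wstar_def)

lemma pstar_pstar [simp]: "pstar (pstar p) = p"
  by (simp add: fun_eq_iff pstar_alt)

lemma pstar_wrd [simp]: "pstar (wrd w) = wrd (wstar w)"
  by (auto simp: fun_eq_iff pstar_alt wrd_def wstar_eq_iff)

lemma pstar_pone [simp]: "pstar pone = pone"
  by (simp add: pone_def)

lemma pstar_gen [simp]: "pstar (gen g) = sgen g" "pstar (sgen g) = gen g"
  by (simp_all add: gen_def sgen_def)

lemma pstar_pmult [simp]:
  fixes p q :: "'g fpoly"
  shows "pstar (pmult p q) = pmult (pstar q) (pstar p)"
proof
  fix w :: "('g \<times> bool) list"
  let ?n = "length w"
  have *: "take k (wstar w) = wstar (drop (?n - k) w)" "drop k (wstar w) = wstar (take (?n - k) w)" for k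
    by (simp_all add: wstar_def take_rev drop_rev take_map drop_map)
  have "pstar (pmult p q) w = (\<Sum>k\<le>?n. cnj (p (take k (wstar w))) * cnj (q (drop k (wstar w))))"
    by (simp add: pstar_alt pmult_def)
  also have "\<dots> = (\<Sum>k\<le>?n. pstar q (take (?n - k) w) * pstar p (drop (?n - k) w))"
    by (simp add: * pstar_alt mult.commute)
  \<comment> \<open>A cut after \<open>k\<close> letters of the reversed word is a cut after
    \<open>?n - k\<close> letters of \<open>w\<close>.\<close>
  also have "\<dots> = (\<Sum>k\<le>?n. pstar q (take k w) * pstar p (drop k w))"
    by (rule sum.reindex_bij_witness[of _ "\<lambda>k. ?n - k" "\<lambda>k. ?n - k"]) auto
  finally show "pstar (pmult p q) w = pmult (pstar q) (pstar p) w"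
    by (simp add: pmult_def)
qed

section \<open>Finitely supported elements\<close>

lemma fsupp_zero [simp]: "fsupp 0"
  by (simp add: fpoly_pointwise fsupp_def)

lemma fsupp_wrd [simp]: "fsupp (wrd w)"
  by (simp add: fsupp_def wrd_def)

lemma fsupp_atoms [simp]: "fsupp pone" "fsupp (gen g)" "fsupp (sgen g)"
  by (simp_all add: pone_def gen_def sgen_def)

lemma fsupp_add [simp]: "fsupp p \<Longrightarrow> fsupp q \<Longrightarrow> fsupp (p + q)"
  unfolding fsupp_def by (rule finite_subset[of _ "{w. p w \<noteq> 0} \<union> {w. q w \<noteq> 0}"]) (auto simp: fpoly_pointwise)

lemma fsupp_diff [simp]: "fsupp p \<Longrightarrow> fsupp q \<Longrightarrow> fsupp (p - q)"
  unfolding fsupp_def by (rule finite_subset[of _ "{w. p w \<noteq> 0} \<union> {w. q w \<noteq> 0}"]) (auto simp: fpoly_pointwise)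

lemma fsupp_psc [simp]: "fsupp p \<Longrightarrow> fsupp (psc c p)"
  unfolding fsupp_def psc_def by (rule finite_subset[of _ "{w. p w \<noteq> 0}"]) auto

lemma fsupp_sum [simp]: "(\<And>x. x \<in> A \<Longrightarrow> fsupp (f x)) \<Longrightarrow> fsupp (sum f A)"
  by (induction A rule: infinite_finite_induct) auto

lemma sum_fpoly_apply: "(\<Sum>x\<in>A. f x :: 'g fpoly) w = (\<Sum>x\<in>A. f x w)"
  by (induction A rule: infinite_finite_induct) (simp_all add: fpoly_pointwise)

lemma fsupp_decomp:
  assumes "fsupp p"
  shows "p = (\<Sum>w\<in>{w. p w \<noteq> 0}. psc (p w) (wrd w))"
proof
  fix v
  have "(\<Sum>w\<in>{w. p w \<noteq> 0}. psc (p w) (wrd w)) v = (\<Sum>w\<in>{w. p w \<noteq> 0}. if w = v then p v else 0)"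
    using assms by (auto simp: sum_fpoly_apply psc_def wrd_def intro!: sum.cong)
  then show "p v = (\<Sum>w\<in>{w. p w \<noteq> 0}. psc (p w) (wrd w)) v"
    using assms by (simp add: fsupp_def)
qed

text \<open>Words span the finitely supported elements, so a property stable under sums needs
  checking only on scalar multiples of words.\<close>

lemma fsupp_induct [consumes 1, case_names zero wrd add]:
  assumes "fsupp p" and z: "P 0" and w: "\<And>c w. P (psc c (wrd w))"
    and a: "\<And>p q. fsupp p \<Longrightarrow> fsupp q \<Longrightarrow> P p \<Longrightarrow> P q \<Longrightarrow> P (p + q)"
  shows "P p"
proof -
  have "P (\<Sum>w\<in>W. psc (p w) (wrd w))" if "finite W" for W
    using that by induction (auto intro!: z w a)
  then show ?thesis
    using fsupp_decomp[OF assms(1)] assms(1) by (metis fsupp_def)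
qed

lemma fsupp_pmult [simp]:
  assumes "fsupp p" "fsupp q"
  shows "fsupp (pmult p q)"
  using assms(1)
proof (induction rule: fsupp_induct)
  case (wrd c w)
  from assms(2) show ?case
    by (induction rule: fsupp_induct) (auto simp: pmult_add_right psc_add_right)
qed (auto simp: pmult_add_left)

lemma fsupp_pstar [simp]:
  assumes "fsupp p" shows "fsupp (pstar p)"
  using assms by (induction rule: fsupp_induct) (auto simp: pstar_add)

section \<open>Substitution as a star-homomorphism\<close>

lemma fsupp_weval [simp]:
  assumes "\<And>g. fsupp (f g)" shows "fsupp (weval f w)"
  using assms by (induction f w rule: weval.induct) auto

lemma fsupp_peval [simp]:
  assumes "\<And>g. fsupp (f g)" shows "fsupp (peval f p)"
  using assms by (simp add: peval_def)

text \<open>The supports of \<open>p\<close>, \<open>q\<close> and \<open>p + q\<close> can differ;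
  over a common finite set of words additivity is a termwise matter.\<close>

lemma peval_superset:
  assumes "finite W" "{w. p w \<noteq> 0} \<subseteq> W"
  shows "peval f p = (\<Sum>w\<in>W. psc (p w) (weval f w))"
  unfolding peval_def using assms by (intro sum.mono_neutral_left) auto

lemma peval_zero [simp]: "peval f 0 = 0"
  by (simp add: fpoly_pointwise peval_def)

lemma peval_add [simp]:
  assumes "fsupp p" "fsupp q" shows "peval f (p + q) = peval f p + peval f q"
proof -
  let ?W = "{w. p w \<noteq> 0} \<union> {w. q w \<noteq> 0}"
  have fin: "finite ?W" using assms by (simp add: fsupp_def)
  have "peval f (p + q) = (\<Sum>w\<in>?W. psc ((p + q) w) (weval f w))"
    by (rule peval_superset[OF fin]) (auto simp: fpoly_pointwise)
  also have "\<dots> = (\<Sum>w\<in>?W. psc (p w) (weval f w)) + (\<Sum>w\<in>?W. psc (q w) (weval f w))"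
    by (simp add: fpoly_pointwise psc_add_left sum.distrib)
  also have "\<dots> = peval f p + peval f q"
    by (simp add: peval_superset[OF fin, of p] peval_superset[OF fin, of q])
  finally show ?thesis .
qed

lemma peval_psc [simp]:
  assumes "fsupp p" shows "peval f (psc c p) = psc c (peval f p)"
proof -
  have "peval f (psc c p) = (\<Sum>w\<in>{w. p w \<noteq> 0}. psc (psc c p w) (weval f w))"
    using assms by (intro peval_superset) (auto simp: fsupp_def psc_def)
  then show ?thesis by (simp add: peval_def psc_sum_right psc_def[of c p])
qed

lemma peval_diff [simp]:
  assumes "fsupp p" "fsupp q" shows "peval f (p - q) = peval f p - peval f q"
  using peval_add[of "p - q" q f] assms by (simp add: eq_diff_eq)

lemma peval_sum [simp]:
  assumes "\<And>x. x \<in> A \<Longrightarrow> fsupp (g x)"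
  shows "peval f (sum g A) = (\<Sum>x\<in>A. peval f (g x))"
  using assms by (induction A rule: infinite_finite_induct) auto

lemma peval_wrd: "peval f (wrd w) = weval f w"
  using peval_superset[of "{w}" "wrd w" f] by (simp add: wrd_def)

lemma peval_atoms [simp]:
  "peval f pone = pone" "peval f (gen g) = f g" "peval f (sgen g) = pstar (f g)"
  by (simp_all add: pone_def gen_def sgen_def peval_wrd)
    (simp_all add: pone_def[symmetric])

lemma weval_append: "weval f (u @ v) = pmult (weval f u) (weval f v)"
  by (induction f u rule: weval.induct) (auto simp: pmult_assoc)

lemma weval_wstar: "weval f (wstar w) = pstar (weval f w)"
  by (induction f w rule: weval.induct) (auto simp: weval_append)

lemma peval_pmult [simp]:
  assumes "fsupp p" "fsupp q" shows "peval f (pmult p q) = pmult (peval f p) (peval f q)"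
  using assms(1)
proof (induction rule: fsupp_induct)
  case (wrd c w)
  from assms(2) show ?case
    by (induction rule: fsupp_induct)
      (auto simp: pmult_add_right psc_add_right peval_wrd weval_append)
qed (auto simp: pmult_add_left assms)

lemma peval_pstar [simp]:
  assumes "fsupp p" shows "peval f (pstar p) = pstar (peval f p)"
  using assms
  by (induction rule: fsupp_induct) (auto simp: pstar_add peval_wrd weval_wstar)

section \<open>Star-ideals and congruence\<close>

lemma ideal_of_psc: "x \<in> ideal_of R \<Longrightarrow> psc c x \<in> ideal_of R"
  by (induction rule: ideal_of.induct) (auto simp: psc_add_right intro: ideal_of.intros)

lemma ideal_of_wrd_left: "x \<in> ideal_of R \<Longrightarrow> pmult (wrd w) x \<in> ideal_of R"
proof (induction rule: ideal_of.induct)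
  case (gen r c u v)
  then have "psc c (pmult (pmult (wrd (w @ u)) r) (wrd v)) \<in> ideal_of R"
    by (rule ideal_of.gen)
  then show ?case by (simp flip: pmult_assoc)
qed (auto simp: pmult_add_right intro: ideal_of.intros)

lemma ideal_of_wrd_right: "x \<in> ideal_of R \<Longrightarrow> pmult x (wrd w) \<in> ideal_of R"
proof (induction rule: ideal_of.induct)
  case (gen r c u v)
  then have "psc c (pmult (pmult (wrd u) r) (wrd (v @ w))) \<in> ideal_of R"
    by (rule ideal_of.gen)
  then show ?case by (simp add: pmult_assoc)
qed (auto simp: pmult_add_left intro: ideal_of.intros)

text \<open>The generating set contains the star of every relation, and the star exchanges the two
  outer words.\<close>

lemma pstar_star_ideal: "x \<in> star_ideal R \<Longrightarrow> pstar x \<in> star_ideal R"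
  unfolding star_ideal_def
proof (induction rule: ideal_of.induct)
  case (gen r c u v)
  then have "pstar r \<in> R \<union> pstar ` R" by auto
  then have "psc (cnj c) (pmult (pmult (wrd (wstar v)) (pstar r)) (wrd (wstar u)))
      \<in> ideal_of (R \<union> pstar ` R)"
    by (rule ideal_of.gen)
  then show ?case by (simp add: pmult_assoc)
qed (auto simp: pstar_add intro: ideal_of.intros)

lemma star_ideal_base: "r \<in> R \<Longrightarrow> r \<in> star_ideal R"
  unfolding star_ideal_def
  using ideal_of.gen[of r "R \<union> pstar ` R" 1 "[]" "[]"] by (simp flip: pone_def)

text \<open>An abstract ideal gives one calculus of congruences for both presentations and for the
  tensor square. Factors must be finitely supported, since only these are elements of the free
  algebra.\<close>

locale sideal =
  fixes I :: "'g fpoly set"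
  assumes zero_mem: "0 \<in> I"
    and add_mem: "\<And>x y. x \<in> I \<Longrightarrow> y \<in> I \<Longrightarrow> x + y \<in> I"
    and psc_mem: "\<And>c x. x \<in> I \<Longrightarrow> psc c x \<in> I"
    and left_mem: "\<And>x p. fsupp p \<Longrightarrow> x \<in> I \<Longrightarrow> pmult p x \<in> I"
    and right_mem: "\<And>x p. fsupp p \<Longrightarrow> x \<in> I \<Longrightarrow> pmult x p \<in> I"
    and star_mem: "\<And>x. x \<in> I \<Longrightarrow> pstar x \<in> I"
begin

lemma diff_mem: "x \<in> I \<Longrightarrow> y \<in> I \<Longrightarrow> x - y \<in> I"
  using add_mem[of x "psc (-1) y"] psc_mem[of y "-1"] by (simp add: psc_def fun_diff_def plus_fun_def)

definition cg :: "'g fpoly \<Rightarrow> 'g fpoly \<Rightarrow> bool" (infix "\<approx>" 50) where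
  "x \<approx> y \<longleftrightarrow> x - y \<in> I"

lemma cg_refl [simp]: "x \<approx> x"
  by (simp add: cg_def zero_mem)

lemma cg_sym: "x \<approx> y \<Longrightarrow> y \<approx> x"
  unfolding cg_def using diff_mem[of 0 "x - y"] zero_mem by simp

lemma cg_trans [trans]: "x \<approx> y \<Longrightarrow> y \<approx> z \<Longrightarrow> x \<approx> z"
  unfolding cg_def using add_mem[of "x - y" "y - z"] by simp

lemma eq_cg_trans [trans]: "x = y \<Longrightarrow> y \<approx> z \<Longrightarrow> x \<approx> z"
  by simp

lemma cg_eq_trans [trans]: "x \<approx> y \<Longrightarrow> y = z \<Longrightarrow> x \<approx> z"
  by simp

lemma zero_iff: "x \<approx> 0 \<longleftrightarrow> x \<in> I"
  by (simp add: cg_def)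

lemma cg_add: "x \<approx> y \<Longrightarrow> x' \<approx> y' \<Longrightarrow> x + x' \<approx> y + y'"
  unfolding cg_def using add_mem[of "x - y" "x' - y'"] by (simp add: algebra_simps)

lemma cg_diff: "x \<approx> y \<Longrightarrow> x' \<approx> y' \<Longrightarrow> x - x' \<approx> y - y'"
  unfolding cg_def using diff_mem[of "x - y" "x' - y'"] by (simp add: algebra_simps)

lemma cg_psc: "x \<approx> y \<Longrightarrow> psc c x \<approx> psc c y"
  unfolding cg_def using psc_mem[of "x - y" c] by (simp add: psc_diff_right)

lemma cg_sum: "(\<And>k. k \<in> A \<Longrightarrow> f k \<approx> g k) \<Longrightarrow> sum f A \<approx> sum g A"
  by (induction A rule: infinite_finite_induct) (auto intro: cg_add)

lemma cg_star: "x \<approx> y \<Longrightarrow> pstar x \<approx> pstar y"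
  unfolding cg_def using star_mem[of "x - y"] by (simp add: pstar_diff)

lemma cg_mult:
  assumes "x \<approx> y" "x' \<approx> y'" "fsupp y" "fsupp x'"
  shows "pmult x x' \<approx> pmult y y'"
proof -
  \<comment> \<open>Telescoping: \<open>x x' - y y' = (x - y) x' + y (x' - y')\<close>, which is why
    finite support is asked of \<open>y\<close> and \<open>x'\<close>.\<close>
  have "pmult (x - y) x' + pmult y (x' - y') \<in> I"
    using assms by (intro add_mem left_mem right_mem) (auto simp: cg_def)
  then show ?thesis
    by (simp add: cg_def pmult_diff_left pmult_diff_right)
qed

end

lemma sideal_star_ideal: "sideal (star_ideal R)"
proof
  fix p x assume p: "fsupp (p :: 'a fpoly)" and x: "x \<in> star_ideal R"
  show "pmult p x \<in> star_ideal R" using p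
    by (induction rule: fsupp_induct)
      (use x in \<open>auto simp: star_ideal_def pmult_add_left
        intro: ideal_of.intros ideal_of_psc ideal_of_wrd_left\<close>)
  show "pmult x p \<in> star_ideal R" using p
    by (induction rule: fsupp_induct)
      (use x in \<open>auto simp: star_ideal_def pmult_add_right
        intro: ideal_of.intros ideal_of_psc ideal_of_wrd_right\<close>)
qed (auto simp: pstar_star_ideal, auto simp: star_ideal_def intro: ideal_of.intros ideal_of_psc)

text \<open>The substitution \<open>f\<close> descends to the quotient. Finite support runs along in
  the induction because additivity of \<open>peval\<close> is available for finitely supported
  elements.\<close>

lemma peval_star_ideal:
  assumes I: "sideal I" and f: "\<And>g. fsupp (f g)"
    and R: "\<And>r. r \<in> R \<Longrightarrow> fsupp r \<and> peval f r \<in> I" and x: "x \<in> star_ideal R"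
  shows "peval f x \<in> I"
proof -
  interpret sideal I by fact
  have "fsupp x \<and> peval f x \<in> I" using x unfolding star_ideal_def
  proof (induction rule: ideal_of.induct)
    case (gen r c u v)
    then have "fsupp r \<and> peval f r \<in> I" using R by (auto simp: star_mem)
    then show ?case by (simp add: f psc_mem left_mem right_mem)
  qed (auto intro: add_mem zero_mem)
  then show ?thesis ..
qed

section \<open>Intertwiners modulo a star-ideal\<close>

context sideal
begin

text \<open>Entrywise form of \<open>T V = W T\<close> modulo \<open>I\<close> for a scalar matrix
  \<open>T\<close>. Two index sets let m and its adjoint, maps between l^2(X) and its tensor square,
  count as intertwiners.\<close>

definition intertwiner :: "'p set \<Rightarrow> 'q set \<Rightarrow> ('p \<Rightarrow> 'p \<Rightarrow> 'g fpoly) \<Rightarrow> ('q \<Rightarrow> 'q \<Rightarrow> 'g fpoly)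
    \<Rightarrow> ('q \<Rightarrow> 'p \<Rightarrow> complex) \<Rightarrow> bool" where
  "intertwiner P Q V W T \<longleftrightarrow> (\<forall>q\<in>Q. \<forall>p\<in>P.
     (\<Sum>k\<in>P. psc (T q k) (V k p)) \<approx> (\<Sum>k\<in>Q. psc (T k p) (W q k)))"

lemma intertwiner_cong:
  assumes "intertwiner P Q V W S" "\<And>q p. q \<in> Q \<Longrightarrow> p \<in> P \<Longrightarrow> T q p = S q p"
  shows "intertwiner P Q V W T"
proof -
  have "(\<Sum>k\<in>P. psc (T q k) (V k p)) = (\<Sum>k\<in>P. psc (S q k) (V k p))"
    "(\<Sum>k\<in>Q. psc (T k p) (W q k)) = (\<Sum>k\<in>Q. psc (S k p) (W q k))"
    if "q \<in> Q" "p \<in> P" for p q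
    using that assms(2) by (simp_all cong: sum.cong)
  with assms(1) show ?thesis by (simp add: intertwiner_def)
qed

lemma intertwiner_diff:
  assumes "intertwiner P Q V W S" "intertwiner P Q V W T"
  shows "intertwiner P Q V W (\<lambda>q p. S q p - T q p)"
  using assms by (simp add: intertwiner_def psc_diff_left sum_subtractf cg_diff)

lemma intertwiner_comp:
  assumes S: "intertwiner P Q V W S" and T: "intertwiner Q R W Z T"
  shows "intertwiner P R V Z (\<lambda>r p. \<Sum>q\<in>Q. T r q * S q p)"
  unfolding intertwiner_def
proof (intro ballI)
  fix r p assume r: "r \<in> R" and p: "p \<in> P"
  have "(\<Sum>k\<in>P. psc (\<Sum>q\<in>Q. T r q * S q k) (V k p))
      = (\<Sum>q\<in>Q. psc (T r q) (\<Sum>k\<in>P. psc (S q k) (V k p)))"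
    unfolding psc_sum_left psc_sum_right by (subst sum.swap) simp
  also have "\<dots> \<approx> (\<Sum>q\<in>Q. psc (T r q) (\<Sum>k\<in>Q. psc (S k p) (W q k)))"
    using S p by (intro cg_sum cg_psc) (simp add: intertwiner_def)
  also have "\<dots> = (\<Sum>k\<in>Q. psc (S k p) (\<Sum>q\<in>Q. psc (T r q) (W q k)))"
    unfolding psc_sum_right by (subst sum.swap) (simp add: mult.commute)
  also have "\<dots> \<approx> (\<Sum>k\<in>Q. psc (S k p) (\<Sum>q\<in>R. psc (T q k) (Z r q)))"
    using T r by (intro cg_sum cg_psc) (simp add: intertwiner_def)
  also have "\<dots> = (\<Sum>q\<in>R. psc (\<Sum>k\<in>Q. T q k * S k p) (Z r q))"
    unfolding psc_sum_left psc_sum_right by (subst sum.swap) (simp add: mult.commute)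
  finally show "(\<Sum>k\<in>P. psc (\<Sum>q\<in>Q. T r q * S q k) (V k p))
      \<approx> (\<Sum>k\<in>R. psc (\<Sum>q\<in>Q. T k q * S q p) (Z r k))" .
qed

text \<open>Stars turn \<open>T V = W T\<close> into \<open>V^* T^* = T^* W^*\<close>; multiplying
  by \<open>V\<close> on the left and \<open>W\<close> on the right and cancelling
  \<open>V V^*\<close> and \<open>W^* W\<close> leaves \<open>T^* W = V T^*\<close>.\<close>

lemma intertwiner_adj:
  assumes T: "intertwiner P Q V W T" and fin: "finite P" "finite Q"
    and fs: "\<And>i j. fsupp (V i j)" "\<And>i j. fsupp (W i j)"
    and VV: "\<And>i k. i \<in> P \<Longrightarrow> k \<in> P \<Longrightarrow>
      (\<Sum>p\<in>P. pmult (V i p) (pstar (V k p))) \<approx> (if i = k then pone else 0)"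
    and WW: "\<And>k j. k \<in> Q \<Longrightarrow> j \<in> Q \<Longrightarrow>
      (\<Sum>q\<in>Q. pmult (pstar (W q k)) (W q j)) \<approx> (if k = j then pone else 0)"
  shows "intertwiner Q P W V (\<lambda>p q. cnj (T q p))"
  unfolding intertwiner_def
proof (intro ballI)
  fix i j assume i: "i \<in> P" and j: "j \<in> Q"
  \<comment> \<open>\<open>g q p\<close> and \<open>h q p\<close> are the entries in row
    \<open>p\<close> and column \<open>q\<close> of \<open>V^* T^*\<close> and
    \<open>T^* W^*\<close>.\<close>
  define g where "g q p = (\<Sum>k\<in>P. psc (cnj (T q k)) (pstar (V k p)))" for q p
  define h where "h q p = (\<Sum>k\<in>Q. psc (cnj (T k p)) (pstar (W q k)))" for q p
  have gh: "g q p \<approx> h q p" if "q \<in> Q" "p \<in> P" for q p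
  proof -
    have "(\<Sum>k\<in>P. psc (T q k) (V k p)) \<approx> (\<Sum>k\<in>Q. psc (T k p) (W q k))"
      using that T by (simp add: intertwiner_def)
    from cg_star[OF this] show ?thesis
      by (simp add: g_def h_def pstar_sum)
  qed
  have fgh: "fsupp (g q p)" "fsupp (h q p)" for q p
    by (simp_all add: g_def h_def fs)
  have "(\<Sum>q\<in>Q. \<Sum>p\<in>P. pmult (pmult (V i p) (g q p)) (W q j))
      = (\<Sum>q\<in>Q. \<Sum>k\<in>P. psc (cnj (T q k))
          (pmult (\<Sum>p\<in>P. pmult (V i p) (pstar (V k p))) (W q j)))" (is "?L = _")
    unfolding g_def pmult_sum_right pmult_sum_left pmult_psc_left pmult_psc_right psc_sum_right
    by (rule sum.cong[OF refl], rule sum.swap)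
  also have "\<dots> \<approx> (\<Sum>q\<in>Q. \<Sum>k\<in>P. psc (cnj (T q k))
          (pmult (if i = k then pone else 0) (W q j)))"
    by (intro cg_sum cg_psc cg_mult VV i) (simp_all add: fs)
  also have "\<dots> = (\<Sum>q\<in>Q. \<Sum>k\<in>P. if i = k then psc (cnj (T q k)) (W q j) else 0)"
    by (intro sum.cong) auto
  also have "\<dots> = (\<Sum>q\<in>Q. psc (cnj (T q i)) (W q j))"
    using i fin by (simp add: sum.delta)
  finally have 1: "?L \<approx> (\<Sum>q\<in>Q. psc (cnj (T q i)) (W q j))" .
  have "(\<Sum>q\<in>Q. \<Sum>p\<in>P. pmult (pmult (V i p) (h q p)) (W q j))
      = (\<Sum>p\<in>P. \<Sum>k\<in>Q. psc (cnj (T k p))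
          (pmult (V i p) (\<Sum>q\<in>Q. pmult (pstar (W q k)) (W q j))))" (is "?R = _")
    unfolding h_def pmult_sum_right pmult_sum_left pmult_psc_left pmult_psc_right psc_sum_right
      pmult_assoc
    by (subst sum.swap) (rule sum.cong[OF refl], rule sum.swap)
  also have "\<dots> \<approx> (\<Sum>p\<in>P. \<Sum>k\<in>Q. psc (cnj (T k p))
          (pmult (V i p) (if k = j then pone else 0)))"
    by (intro cg_sum cg_psc cg_mult WW j) (simp_all add: fs)
  also have "\<dots> = (\<Sum>p\<in>P. \<Sum>k\<in>Q. if k = j then psc (cnj (T k p)) (V i p) else 0)"
    by (intro sum.cong) auto
  also have "\<dots> = (\<Sum>p\<in>P. psc (cnj (T j p)) (V i p))"
    using j fin by (simp add: sum.delta)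
  finally have 2: "?R \<approx> (\<Sum>p\<in>P. psc (cnj (T j p)) (V i p))" .
  have "?L \<approx> ?R"
    by (intro cg_sum cg_mult gh) (simp_all add: fs fgh)
  with 1 2 show "(\<Sum>k\<in>Q. psc (cnj (T k i)) (W k j)) \<approx> (\<Sum>k\<in>P. psc (cnj (T j k)) (V i k))"
    by (meson cg_sym cg_trans)
qed

definition tens :: "('a \<Rightarrow> 'a \<Rightarrow> 'g fpoly) \<Rightarrow> 'a \<times> 'a \<Rightarrow> 'a \<times> 'a \<Rightarrow> 'g fpoly" where
  "tens V = (\<lambda>(i, j) (p, q). pmult (V i p) (V j q))"

lemma intertwiner_tens:
  assumes S: "intertwiner P P V V S" and T: "intertwiner P P V V T" and fs: "\<And>i j. fsupp (V i j)"
  shows "intertwiner (P \<times> P) (P \<times> P) (tens V) (tens V) (\<lambda>(i, j) (p, q). S i p * T j q)"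
proof -
  have *: "(\<Sum>k\<in>P. psc (S i k) (V k p)) \<approx> (\<Sum>k\<in>P. psc (S k p) (V i k))"
    "(\<Sum>k\<in>P. psc (T i k) (V k p)) \<approx> (\<Sum>k\<in>P. psc (T k p) (V i k))"
    if "i \<in> P" "p \<in> P" for i p
    using S T that by (auto simp: intertwiner_def)
  have "pmult (\<Sum>k\<in>P. psc (S i k) (V k p)) (\<Sum>k\<in>P. psc (T j k) (V k q)) \<approx>
      pmult (\<Sum>k\<in>P. psc (S k p) (V i k)) (\<Sum>k\<in>P. psc (T k q) (V j k))"
    if "i \<in> P" "j \<in> P" "p \<in> P" "q \<in> P" for i j p q
    using that by (intro cg_mult *) (simp_all add: fs)
  then show ?thesis
    unfolding intertwiner_def
    by (auto simp: tens_def pmult_sum_sum sum.cartesian_product' case_prod_beta mult.commute)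
qed

end

section \<open>Matrices commuting with a representation of Qut(X)\<close>

lemma finite_idx [simp]: "finite (idx ns)"
proof -
  have "idx ns \<subseteq> {..<length ns} \<times> (\<Union>k<length ns. {..<ns ! k} \<times> {..<ns ! k})"
    by (auto simp: idx_def)
  then show ?thesis by (rule finite_subset) auto
qed

text \<open>The relations of \<open>qut_base\<close> for an arbitrary matrix over an arbitrary
  quotient, so that generators, corners and direct sums are all instances.\<close>

locale qut_rep = sideal I for I :: "'g fpoly set" +
  fixes ns :: "nat list" and U :: "ix \<Rightarrow> ix \<Rightarrow> 'g fpoly"
  assumes fs [simp]: "\<And>i j. fsupp (U i j)"
    and out: "\<And>i j. (i, j) \<notin> idx ns \<times> idx ns \<Longrightarrow> U i j \<in> I"
    and UUs: "\<And>i j. i \<in> idx ns \<Longrightarrow> j \<in> idx ns \<Longrightarrow>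
      cg (\<Sum>k\<in>idx ns. pmult (U i k) (pstar (U j k))) (if i = j then pone else 0)"
    and UsU: "\<And>i j. i \<in> idx ns \<Longrightarrow> j \<in> idx ns \<Longrightarrow>
      cg (\<Sum>k\<in>idx ns. pmult (pstar (U k i)) (U k j)) (if i = j then pone else 0)"
    and Um: "\<And>l i j. l \<in> idx ns \<Longrightarrow> i \<in> idx ns \<Longrightarrow> j \<in> idx ns \<Longrightarrow>
      cg (\<Sum>p\<in>idx ns. \<Sum>q\<in>idx ns. psc (mc ns l p q) (pmult (U p i) (U q j)))
         (\<Sum>r\<in>idx ns. psc (mc ns r i j) (U l r))"
    and Ueta: "\<And>i. i \<in> idx ns \<Longrightarrow>
      cg (\<Sum>j\<in>idx ns. psc (eta ns j) (U i j)) (psc (eta ns i) pone)"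
begin

definition comm :: "mat \<Rightarrow> bool" where
  "comm = intertwiner (idx ns) (idx ns) U U"

lemma comm_iff: "comm A \<longleftrightarrow> (\<forall>i\<in>idx ns. \<forall>j\<in>idx ns.
    (\<Sum>k\<in>idx ns. psc (A k j) (U i k)) \<approx> (\<Sum>k\<in>idx ns. psc (A i k) (U k j)))"
  unfolding comm_def intertwiner_def using cg_sym by blast

lemma comm_cong: "comm A \<Longrightarrow> meq ns A B \<Longrightarrow> comm B"
  unfolding comm_def by (erule intertwiner_cong) (simp add: meq_def)

lemma comm_diff: "comm A \<Longrightarrow> comm B \<Longrightarrow> comm (\<lambda>i j. A i j - B i j)"
  unfolding comm_def by (rule intertwiner_diff)

lemma comm_mult: "comm A \<Longrightarrow> comm B \<Longrightarrow> comm (\<lambda>i j. \<Sum>k\<in>idx ns. A i k * B k j)"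
  unfolding comm_def by (rule intertwiner_comp)

lemma comm_madj: "comm A \<Longrightarrow> comm (madj A)"
  unfolding comm_def madj_def by (erule intertwiner_adj) (simp_all only: finite_idx fs UUs UsU)

lemma comm_zero: "comm (\<lambda>_ _. 0)"
  by (simp add: comm_iff)

lemma comm_mid: "comm mid"
  by (simp add: comm_iff mid_def if_distrib[of "\<lambda>c. psc c _"] sum.delta cong: if_cong)

lemma fsupp_tens: "fsupp (tens U x y)"
  by (simp add: tens_def case_prod_beta)

lemma tens_unitary:
  assumes "x \<in> idx ns \<times> idx ns" "y \<in> idx ns \<times> idx ns"
  shows "(\<Sum>z\<in>idx ns \<times> idx ns. pmult (tens U x z) (pstar (tens U y z)))
    \<approx> (if x = y then pone else 0)"
proof -
  obtain i j k l where xy: "x = (i, j)" "y = (k, l)" by (cases x, cases y)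
  with assms have in_idx: "i \<in> idx ns" "j \<in> idx ns" "k \<in> idx ns" "l \<in> idx ns" by auto
  \<comment> \<open>The star reverses the two legs, so the sum over the second leg stands innermost
    and collapses first.\<close>
  have "(\<Sum>z\<in>idx ns \<times> idx ns. pmult (tens U x z) (pstar (tens U y z)))
      = (\<Sum>p\<in>idx ns. pmult (U i p) (pmult
          (\<Sum>q\<in>idx ns. pmult (U j q) (pstar (U l q))) (pstar (U k p))))"
    by (simp add: xy tens_def sum.cartesian_product' pmult_sum_left pmult_sum_right pmult_assoc)
  also have "\<dots> \<approx> (\<Sum>p\<in>idx ns. pmult (U i p) (pmult (if j = l then pone else 0) (pstar (U k p))))"
    by (intro cg_sum cg_mult UUs in_idx) simp_all
  also have "\<dots> = (if j = l then (\<Sum>p\<in>idx ns. pmult (U i p) (pstar (U k p))) else 0)"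
    by simp
  also have "\<dots> \<approx> (if j = l then (if i = k then pone else 0) else 0)"
    using UUs in_idx by auto
  also have "\<dots> = (if x = y then pone else 0)"
    by (simp add: xy)
  finally show ?thesis .
qed

lemma intertwiner_mc: "intertwiner (idx ns \<times> idx ns) (idx ns) (tens U) U (\<lambda>l (i, j). mc ns l i j)"
  using Um by (auto simp: intertwiner_def tens_def sum.cartesian_product' case_prod_beta)

text \<open>Unitarity of the tensor square and of \<open>U\<close> turns the relation for m into one
  for its adjoint.\<close>

lemma intertwiner_mc_adj:
  "intertwiner (idx ns) (idx ns \<times> idx ns) U (tens U) (\<lambda>x l. cnj (mc ns l (fst x) (snd x)))"
proof -
  have "intertwiner (idx ns) (idx ns \<times> idx ns) U (tens U) (\<lambda>x l. cnj ((\<lambda>l (i, j). mc ns l i j) l x))"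
    by (rule intertwiner_adj[OF intertwiner_mc])
      (auto simp only: finite_idx finite_cartesian_product fs fsupp_tens tens_unitary UsU)
  then show ?thesis by (simp add: case_prod_beta)
qed

text \<open>\<open>bul\<close> is the composite of the adjoint of m, \<open>A \<otimes> B\<close>
  and m, each of which is an intertwiner.\<close>

lemma comm_bul:
  assumes "comm A" "comm B"
  shows "comm (bul ns A B)"
proof -
  let ?J = "idx ns \<times> idx ns"
  have "intertwiner ?J ?J (tens U) (tens U) (\<lambda>(i, j) (p, q). A i p * B j q)"
    using assms unfolding comm_def by (rule intertwiner_tens) simp
  from intertwiner_comp[OF intertwiner_mc_adj intertwiner_comp[OF this intertwiner_mc]]
  show ?thesis unfolding comm_def
  proof (rule intertwiner_cong)
    fix l l'
    show "bul ns A B l l' = (\<Sum>q\<in>?J. (\<Sum>qa\<in>?J. (case qa of (i, j) \<Rightarrow> mc ns l i j)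
        * (case qa of (i, j) \<Rightarrow> \<lambda>(p, q). A i p * B j q) q) * cnj (mc ns l' (fst q) (snd q)))"
      unfolding bul_def sum_distrib_right
      by (subst (2) sum.swap) (simp add: sum.cartesian_product' case_prod_beta mult.assoc)
  qed
qed

end

section \<open>Copies of a finite quantum set\<close>

definition copies :: "nat \<Rightarrow> nat list \<Rightarrow> nat list" where
  "copies N ns = map (\<lambda>k. ns ! (k mod length ns)) [0..<N * length ns]"

text \<open>Inverse to the coordinates \<open>cpy\<close> and \<open>bas\<close>: summand
  \<open>k\<close> of copy \<open>c\<close> stands at position
  \<open>c * length ns + k\<close>.\<close>

definition emb :: "nat list \<Rightarrow> nat \<Rightarrow> ix \<Rightarrow> ix" where
  "emb ns c x = (c * length ns + fst x, snd x)"

definition cpy :: "nat list \<Rightarrow> ix \<Rightarrow> nat" where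
  "cpy ns x = fst x div length ns"

definition bas :: "nat list \<Rightarrow> ix \<Rightarrow> ix" where
  "bas ns x = (fst x mod length ns, snd x)"

definition blk :: "nat list \<Rightarrow> (nat \<Rightarrow> nat \<Rightarrow> mat) \<Rightarrow> mat" where
  "blk ns B x y = B (cpy ns x) (cpy ns y) (bas ns x) (bas ns y)"

text \<open>Direct sum of equal copies of \<open>W\<close>, set to 0 outside the index set to match
  the convention of \<open>qut_base\<close> for generators out of range.\<close>

definition diag :: "nat list \<Rightarrow> nat list \<Rightarrow> (ix \<Rightarrow> ix \<Rightarrow> 'g fpoly) \<Rightarrow> ix \<Rightarrow> ix \<Rightarrow> 'g fpoly" where
  "diag ns ns' W x y = (if x \<in> idx ns' \<and> y \<in> idx ns' \<and> cpy ns x = cpy ns y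
     then W (bas ns x) (bas ns y) else 0)"

lemma idx_length: "x \<in> idx ns \<Longrightarrow> fst x < length ns"
  by (auto simp: idx_def)

lemma emb_simps [simp]:
  assumes "x \<in> idx ns"
  shows "cpy ns (emb ns c x) = c" "bas ns (emb ns c x) = x"
  using idx_length[OF assms]
  by (auto simp: emb_def cpy_def bas_def mult.commute intro!: div_nat_eqI)

lemma emb_cpy_bas [simp]: "emb ns (cpy ns x) (bas ns x) = x"
  by (simp add: emb_def cpy_def bas_def)

lemma ix_eq_iff: "x = y \<longleftrightarrow> cpy ns x = cpy ns y \<and> bas ns x = bas ns y"
  by (metis emb_cpy_bas)

locale copied =
  fixes ns :: "nat list" and N :: nat
  assumes qs: "qset ns" and N0: "0 < N"
begin

abbreviation "ns' \<equiv> copies N ns"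

lemma len0: "0 < length ns"
  using qs by (simp add: qset_def)

lemma nth_copies: "k < N * length ns \<Longrightarrow> ns' ! k = ns ! (k mod length ns)"
  by (simp add: copies_def)

lemma idx_copies: "x \<in> idx ns' \<longleftrightarrow> cpy ns x < N \<and> bas ns x \<in> idx ns"
proof -
  obtain k a b where "x = (k, a, b)" by (cases x)
  moreover have "length ns' = N * length ns" by (simp add: copies_def)
  ultimately show ?thesis
    using len0 by (auto simp: idx_def cpy_def bas_def nth_copies div_less_iff_less_mult)
qed

lemma bas_idx [simp]: "x \<in> idx ns' \<Longrightarrow> bas ns x \<in> idx ns"
  by (simp add: idx_copies)

lemma emb_idx [simp]: "i \<in> idx ns \<Longrightarrow> emb ns c i \<in> idx ns' \<longleftrightarrow> c < N"
  by (simp add: idx_copies)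

lemma qset_copies: "qset ns'"
  using qs len0 N0 by (auto simp: qset_def copies_def)

lemma sum_copies: "(\<Sum>x\<in>idx ns'. f x) = (\<Sum>c<N. \<Sum>i\<in>idx ns. f (emb ns c i))"
  unfolding sum.cartesian_product
  by (rule sum.reindex_bij_witness[of _ "\<lambda>(c, i). emb ns c i" "\<lambda>x. (cpy ns x, bas ns x)"])
    (auto simp: idx_copies)

lemma sum_copy:
  assumes "c < N" "\<And>x. x \<in> idx ns' \<Longrightarrow> cpy ns x \<noteq> c \<Longrightarrow> f x = 0"
  shows "(\<Sum>x\<in>idx ns'. f x) = (\<Sum>i\<in>idx ns. f (emb ns c i))"
proof -
  have "(\<Sum>i\<in>idx ns. f (emb ns d i)) = 0" if "d < N" "d \<noteq> c" for d
    using that by (intro sum.neutral) (simp add: assms(2))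
  then have "(\<Sum>d<N. \<Sum>i\<in>idx ns. f (emb ns d i))
      = (\<Sum>d<N. if d = c then \<Sum>i\<in>idx ns. f (emb ns c i) else 0)"
    by (intro sum.cong) auto
  then show ?thesis using assms(1) by (simp add: sum_copies)
qed

lemma sqn_copies: "x \<in> idx ns' \<Longrightarrow> sqn ns' (fst x) = sqn ns (fst (bas ns x))"
  by (auto simp: sqn_def bas_def idx_def copies_def)

text \<open>Products across different copies vanish, and the factor \<open>1 / sqn\<close> depends
  only on the matrix size, which copying preserves.\<close>

lemma mc_copies:
  assumes "l \<in> idx ns'"
  shows "mc ns' l i j = (if cpy ns i = cpy ns l \<and> cpy ns j = cpy ns l
    then mc ns (bas ns l) (bas ns i) (bas ns j) else 0)"
proof -
  obtain k a c where l: "l = (k, a, c)" by (cases l)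
  obtain k1 a1 c1 where i: "i = (k1, a1, c1)" by (cases i)
  obtain k2 a2 c2 where j: "j = (k2, a2, c2)" by (cases j)
  have "u = v \<longleftrightarrow> u div length ns = v div length ns \<and> u mod length ns = v mod length ns" for u v :: nat
    by (metis div_mult_mod_eq)
  note eq = this[of k1 k] this[of k2 k]
  show ?thesis
    using sqn_copies[OF assms] unfolding mc_def l i j cpy_def bas_def prod.case fst_conv snd_conv eq
    by simp
qed

lemma eta_copies: "x \<in> idx ns' \<Longrightarrow> eta ns' x = eta ns (bas ns x)"
  using sqn_copies[of x] by (cases x) (auto simp: eta_def bas_def)

lemma cpy_invol [simp]: "cpy ns (invol x) = cpy ns x"
  by (cases x) (simp add: invol_def cpy_def)

lemma bas_invol [simp]: "bas ns (invol x) = invol (bas ns x)"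
  by (cases x) (simp add: invol_def bas_def)

text \<open>m multiplies within a single copy, so both tensor legs have their rows in the copy of
  \<open>x\<close> and their columns in that of \<open>y\<close>: Schur products are formed block by
  block.\<close>

lemma bul_blk:
  assumes x: "x \<in> idx ns'" and y: "y \<in> idx ns'"
  shows "bul ns' (blk ns B) (blk ns C) x y
    = bul ns (B (cpy ns x) (cpy ns y)) (C (cpy ns x) (cpy ns y)) (bas ns x) (bas ns y)"
proof -
  let ?f = "\<lambda>i j i' j'. mc ns' x i j * blk ns B i i' * blk ns C j j' * cnj (mc ns' y i' j')"
  have c: "cpy ns x < N" "cpy ns y < N" using x y by (auto simp: idx_copies)
  have "bul ns' (blk ns B) (blk ns C) x y
      = (\<Sum>i\<in>idx ns'. \<Sum>j\<in>idx ns'. \<Sum>i'\<in>idx ns'. \<Sum>j'\<in>idx ns'. ?f i j i' j')"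
    by (simp add: bul_def)
  also have "\<dots> = (\<Sum>i\<in>idx ns. \<Sum>j\<in>idx ns. \<Sum>i'\<in>idx ns. \<Sum>j'\<in>idx ns.
      ?f (emb ns (cpy ns x) i) (emb ns (cpy ns x) j) (emb ns (cpy ns y) i') (emb ns (cpy ns y) j'))"
    by (simp add: sum_copy[OF c(1)] sum_copy[OF c(2)] mc_copies x y cong: sum.cong)
  also have "\<dots> = bul ns (B (cpy ns x) (cpy ns y)) (C (cpy ns x) (cpy ns y)) (bas ns x) (bas ns y)"
    by (simp add: bul_def mc_copies x y blk_def cong: sum.cong)
  finally show ?thesis .
qed

end

section \<open>Schur products with zero, adjoints and the identity\<close>

lemma bul_zero: "bul ns (\<lambda>_ _. 0) B = (\<lambda>_ _. 0)" "bul ns A (\<lambda>_ _. 0) = (\<lambda>_ _. 0)"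
  by (auto simp: bul_def fun_eq_iff)

lemma bul_madj: "bul ns (madj A) (madj B) = madj (bul ns A B)"
proof (intro ext)
  fix l l'
  have "madj (bul ns A B) l l' = (\<Sum>i\<in>idx ns. \<Sum>j\<in>idx ns. \<Sum>i'\<in>idx ns. \<Sum>j'\<in>idx ns.
      cnj (mc ns l' i j * A i i' * B j j' * cnj (mc ns l i' j')))"
    by (simp add: madj_def bul_def)
  also have "\<dots> = (\<Sum>x\<in>idx ns \<times> idx ns. \<Sum>y\<in>idx ns \<times> idx ns.
      mc ns l (fst y) (snd y) * madj A (fst y) (fst x) * madj B (snd y) (snd x)
        * cnj (mc ns l' (fst x) (snd x)))"
    by (simp add: sum.cartesian_product' madj_def mult_ac)
  also have "\<dots> = (\<Sum>y\<in>idx ns \<times> idx ns. \<Sum>x\<in>idx ns \<times> idx ns.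
      mc ns l (fst y) (snd y) * madj A (fst y) (fst x) * madj B (snd y) (snd x)
        * cnj (mc ns l' (fst x) (snd x)))"
    by (rule sum.swap)
  also have "\<dots> = bul ns (madj A) (madj B) l l'"
    by (simp add: bul_def sum.cartesian_product')
  finally show "bul ns (madj A) (madj B) l l' = madj (bul ns A B) l l'" by simp
qed

lemma madj_mid [simp]: "madj mid = mid"
  by (auto simp: madj_def mid_def fun_eq_iff)

lemma madj_madj [simp]: "madj (madj A) = A"
  by (simp add: madj_def)

lemma mbar_mid [simp]: "mbar mid = mid"
  by (auto simp: mbar_def mid_def fun_eq_iff invol_def)

text \<open>This is the normalization \<open>m m^* = id\<close>: a matrix unit splits over
  \<open>ns ! k\<close> middle indices, each contributing \<open>1 / (ns ! k)\<close>.\<close>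

lemma bul_mid_mid:
  assumes ns: "qset ns" and l: "l \<in> idx ns" "l' \<in> idx ns"
  shows "bul ns mid mid l l' = mid l l'"
proof -
  obtain k a c where l_eq: "l = (k, a, c)" by (cases l)
  from l(1) have k: "k < length ns" "a < ns ! k" "c < ns ! k" by (auto simp: idx_def l_eq)
  have "bul ns mid mid l l' = (\<Sum>i\<in>idx ns. \<Sum>j\<in>idx ns. mc ns l i j * cnj (mc ns l' i j))"
    by (auto simp: bul_def mid_def if_distrib[of "\<lambda>x. _ * x"] if_distrib[of "\<lambda>x. x * _"]
        sum.delta cong: if_cong intro!: sum.cong)
  also have "\<dots> = (\<Sum>z\<in>idx ns \<times> idx ns. mc ns l (fst z) (snd z) * cnj (mc ns l' (fst z) (snd z)))"
    by (simp add: sum.cartesian_product')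
  also have "\<dots> = (\<Sum>z\<in>(\<lambda>b. ((k, a, b), (k, b, c))) ` {..<ns ! k}.
      mc ns l (fst z) (snd z) * cnj (mc ns l' (fst z) (snd z)))"
    using k by (intro sum.mono_neutral_right) (simp, auto simp: mc_def l_eq idx_def image_iff split: if_splits)
  also have "\<dots> = (\<Sum>b<ns ! k. mc ns l (k, a, b) (k, b, c) * cnj (mc ns l' (k, a, b) (k, b, c)))"
    by (subst sum.reindex) (auto simp: inj_on_def)
  also have "\<dots> = (\<Sum>b<ns ! k. mid l l' / of_nat (ns ! k))"
  proof (rule sum.cong)
    fix b
    have "sqn ns k * sqn ns k = of_nat (ns ! k)"
      by (simp add: sqn_def flip: of_real_mult)
    then show "mc ns l (k, a, b) (k, b, c) * cnj (mc ns l' (k, a, b) (k, b, c)) = mid l l' / of_nat (ns ! k)"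
      by (cases l') (auto simp: mc_def l_eq mid_def sqn_def)
  qed simp
  also have "\<dots> = mid l l'"
    using k by simp
  finally show ?thesis .
qed

section \<open>Block-diagonal representations\<close>

locale copied_sideal = copied ns N + sideal I for ns N and I :: "'g fpoly set" +
  fixes W :: "ix \<Rightarrow> ix \<Rightarrow> 'g fpoly"
  assumes fsW [simp]: "\<And>i j. fsupp (W i j)"
    and outW: "\<And>i j. (i, j) \<notin> idx ns \<times> idx ns \<Longrightarrow> W i j \<in> I"
begin

abbreviation "D \<equiv> diag ns ns' W"

lemma fsupp_diag: "fsupp (D i j)"
  by (simp add: diag_def)

lemma out_diag: "(i, j) \<notin> idx ns' \<times> idx ns' \<Longrightarrow> D i j \<in> I"
  by (auto simp: diag_def zero_mem)

lemma diag_emb: "c < N \<Longrightarrow> i \<in> idx ns \<Longrightarrow> j \<in> idx ns \<Longrightarrow> D (emb ns c i) (emb ns c j) = W i j"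
  by (simp add: diag_def)

context
  fixes x y z assumes x: "x \<in> idx ns'" and y: "y \<in> idx ns'" and z: "z \<in> idx ns'"
begin

lemma cpyN: "cpy ns x < N" "cpy ns y < N"
  using x y by (auto simp: idx_copies)

text \<open>Nonzero entries of \<open>D\<close> join indices of the same copy, so here and in the
  companions below a sum over all copies collapses to one.\<close>

lemma diag_UUs: "(\<Sum>k\<in>idx ns'. pmult (D x k) (pstar (D y k))) =
    (if cpy ns x = cpy ns y then \<Sum>k\<in>idx ns. pmult (W (bas ns x) k) (pstar (W (bas ns y) k)) else 0)"
  by (subst sum_copy[OF cpyN(1)]) (auto simp: diag_def x y cpyN)

lemma diag_UsU: "(\<Sum>k\<in>idx ns'. pmult (pstar (D k x)) (D k y)) =
    (if cpy ns x = cpy ns y then \<Sum>k\<in>idx ns. pmult (pstar (W k (bas ns x))) (W k (bas ns y)) else 0)"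
  by (subst sum_copy[OF cpyN(1)]) (auto simp: diag_def x y cpyN)

lemma diag_Um1: "(\<Sum>p\<in>idx ns'. \<Sum>q\<in>idx ns'. psc (mc ns' x p q) (pmult (D p y) (D q z))) =
    (if cpy ns y = cpy ns x \<and> cpy ns z = cpy ns x then
      \<Sum>p\<in>idx ns. \<Sum>q\<in>idx ns. psc (mc ns (bas ns x) p q) (pmult (W p (bas ns y)) (W q (bas ns z))) else 0)"
  by (simp add: sum_copy[OF cpyN(1)] mc_copies x cong: sum.cong) (auto simp: diag_def x y z cpyN)

lemma diag_Um2: "(\<Sum>r\<in>idx ns'. psc (mc ns' r y z) (D x r)) =
    (if cpy ns y = cpy ns x \<and> cpy ns z = cpy ns x then
      \<Sum>r\<in>idx ns. psc (mc ns r (bas ns y) (bas ns z)) (W (bas ns x) r) else 0)"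
  by (subst sum_copy[OF cpyN(1)]) (auto simp: diag_def x y z cpyN mc_copies)

lemma diag_Ueta: "(\<Sum>j\<in>idx ns'. psc (eta ns' j) (D x j)) = (\<Sum>j\<in>idx ns. psc (eta ns j) (W (bas ns x) j))"
  by (subst sum_copy[OF cpyN(1)]) (auto simp: diag_def x cpyN eta_copies)

lemma diag_comm:
  "(\<Sum>k\<in>idx ns'. psc (blk ns B k y) (D x k))
    = (\<Sum>k\<in>idx ns. psc (B (cpy ns x) (cpy ns y) k (bas ns y)) (W (bas ns x) k))"
  "(\<Sum>k\<in>idx ns'. psc (blk ns B x k) (D k y))
    = (\<Sum>k\<in>idx ns. psc (B (cpy ns x) (cpy ns y) (bas ns x) k) (W k (bas ns y)))"
  by (subst sum_copy[OF cpyN(1)], auto simp: diag_def x y cpyN blk_def)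
    (subst sum_copy[OF cpyN(2)], auto simp: diag_def x y cpyN blk_def)

end

lemma emb0: "i \<in> idx ns \<Longrightarrow> emb ns 0 i \<in> idx ns'"
  by (simp add: N0)

text \<open>Every relation for \<open>D\<close> is a relation for \<open>W\<close> inside one copy
  or reads 0 = 0 across copies; copy 0 alone already returns all relations for
  \<open>W\<close>.\<close>

lemma diag_rep_iff: "qut_rep I ns' D \<longleftrightarrow> qut_rep I ns W"
proof
  assume "qut_rep I ns' D"
  then interpret R: qut_rep I ns' D .
  show "qut_rep I ns W"
  proof
    fix i j assume i: "i \<in> idx ns" and j: "j \<in> idx ns"
    show "cg (\<Sum>k\<in>idx ns. pmult (W i k) (pstar (W j k))) (if i = j then pone else 0)"
      using R.UUs[OF emb0 emb0, OF i j] i j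
      by (simp add: diag_UUs[OF emb0 emb0 emb0, OF i j j] ix_eq_iff[of "emb ns 0 i" _ ns])
    show "cg (\<Sum>k\<in>idx ns. pmult (pstar (W k i)) (W k j)) (if i = j then pone else 0)"
      using R.UsU[OF emb0 emb0, OF i j] i j
      by (simp add: diag_UsU[OF emb0 emb0 emb0, OF i j j] ix_eq_iff[of "emb ns 0 i" _ ns])
    fix l assume l: "l \<in> idx ns"
    show "cg (\<Sum>p\<in>idx ns. \<Sum>q\<in>idx ns. psc (mc ns l p q) (pmult (W p i) (W q j)))
         (\<Sum>r\<in>idx ns. psc (mc ns r i j) (W l r))"
      using R.Um[OF emb0 emb0 emb0, OF l i j] i j l
      by (simp add: diag_Um1[OF emb0 emb0 emb0, OF l i j] diag_Um2[OF emb0 emb0 emb0, OF l i j])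
  next
    fix i assume i: "i \<in> idx ns"
    show "cg (\<Sum>j\<in>idx ns. psc (eta ns j) (W i j)) (psc (eta ns i) pone)"
      using R.Ueta[OF emb0, OF i, unfolded diag_Ueta[OF emb0 emb0 emb0, OF i i i]] i
      by (simp add: eta_copies N0)
  qed (simp_all add: outW)
next
  assume "qut_rep I ns W"
  then interpret R: qut_rep I ns W .
  show "qut_rep I ns' D"
  proof
    fix i j assume i: "i \<in> idx ns'" and j: "j \<in> idx ns'"
    show "cg (\<Sum>k\<in>idx ns'. pmult (D i k) (pstar (D j k))) (if i = j then pone else 0)"
      using R.UUs[OF bas_idx bas_idx, OF i j]
      by (simp add: diag_UUs[OF i j j] ix_eq_iff[of i j ns] split: if_splits)
    show "cg (\<Sum>k\<in>idx ns'. pmult (pstar (D k i)) (D k j)) (if i = j then pone else 0)"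
      using R.UsU[OF bas_idx bas_idx, OF i j]
      by (simp add: diag_UsU[OF i j j] ix_eq_iff[of i j ns] split: if_splits)
    fix l assume l: "l \<in> idx ns'"
    show "cg (\<Sum>p\<in>idx ns'. \<Sum>q\<in>idx ns'. psc (mc ns' l p q) (pmult (D p i) (D q j)))
         (\<Sum>r\<in>idx ns'. psc (mc ns' r i j) (D l r))"
      using R.Um[OF bas_idx bas_idx bas_idx, OF l i j]
      by (simp add: diag_Um1[OF l i j] diag_Um2[OF l i j])
  next
    fix i assume i: "i \<in> idx ns'"
    show "cg (\<Sum>j\<in>idx ns'. psc (eta ns' j) (D i j)) (psc (eta ns' i) pone)"
      unfolding diag_Ueta[OF i i i] using R.Ueta[OF bas_idx, OF i] i
      by (simp add: eta_copies)
  qed (simp_all add: fsupp_diag out_diag)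
qed

text \<open>A direct sum of equal copies multiplies each block of a block matrix separately.\<close>

lemma diag_comm_iff:
  assumes "qut_rep I ns W"
  shows "qut_rep.comm I ns' D (blk ns B) \<longleftrightarrow> (\<forall>c<N. \<forall>d<N. qut_rep.comm I ns W (B c d))"
proof -
  interpret W: qut_rep I ns W by fact
  interpret D: qut_rep I ns' D using assms by (simp add: diag_rep_iff)
  show ?thesis
  proof
    assume L: "D.comm (blk ns B)"
    show "\<forall>c<N. \<forall>d<N. W.comm (B c d)"
    proof (intro allI impI)
      fix c d assume c: "c < N" and d: "d < N"
      show "W.comm (B c d)"
        unfolding W.comm_iff
      proof (intro ballI)
        fix i j assume "i \<in> idx ns" "j \<in> idx ns"
        then have ij: "i \<in> idx ns" "j \<in> idx ns" "emb ns c i \<in> idx ns'" "emb ns d j \<in> idx ns'"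
          using c d by auto
        show "cg (\<Sum>k\<in>idx ns. psc (B c d k j) (W i k)) (\<Sum>k\<in>idx ns. psc (B c d i k) (W k j))"
          using L[unfolded D.comm_iff, rule_format, OF ij(3,4)]
          by (simp add: diag_comm[OF ij(3,4,4)] ij)
      qed
    qed
  next
    assume "\<forall>c<N. \<forall>d<N. W.comm (B c d)"
    then show "D.comm (blk ns B)"
      unfolding D.comm_iff using diag_comm W.comm_iff by (auto simp: idx_copies)
  qed
qed

end

section \<open>Exchanging a representation for a congruent one\<close>

context qut_rep
begin

lemma comm_rep_cong:
  assumes UV: "\<And>i j. i \<in> idx ns \<Longrightarrow> j \<in> idx ns \<Longrightarrow> U i j \<approx> V i j"
    and V: "qut_rep I ns V" and A: "comm A"
  shows "qut_rep.comm I ns V A"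
proof -
  interpret V: qut_rep I ns V by fact
  show ?thesis
    unfolding V.comm_iff
  proof (intro ballI)
    fix i j assume i: "i \<in> idx ns" and j: "j \<in> idx ns"
    have "(\<Sum>k\<in>idx ns. psc (A k j) (V i k)) \<approx> (\<Sum>k\<in>idx ns. psc (A k j) (U i k))"
      by (intro cg_sum cg_psc cg_sym[OF UV] i)
    also have "\<dots> \<approx> (\<Sum>k\<in>idx ns. psc (A i k) (U k j))"
      using A i j by (simp add: comm_iff)
    also have "\<dots> \<approx> (\<Sum>k\<in>idx ns. psc (A i k) (V k j))"
      by (intro cg_sum cg_psc UV j)
    finally show "(\<Sum>k\<in>idx ns. psc (A k j) (V i k)) \<approx> (\<Sum>k\<in>idx ns. psc (A i k) (V k j))" .
  qed
qed

lemma rep_cong: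
  assumes fsV: "\<And>i j. fsupp (V i j)" and UV: "\<And>i j. i \<in> idx ns \<Longrightarrow> j \<in> idx ns \<Longrightarrow> U i j \<approx> V i j"
    and outV: "\<And>i j. (i, j) \<notin> idx ns \<times> idx ns \<Longrightarrow> V i j \<in> I"
  shows "qut_rep I ns V"
proof
  note VU = cg_sym[OF UV]
  fix i j assume i: "i \<in> idx ns" and j: "j \<in> idx ns"
  have "(\<Sum>k\<in>idx ns. pmult (V i k) (pstar (V j k))) \<approx> (\<Sum>k\<in>idx ns. pmult (U i k) (pstar (U j k)))"
    by (intro cg_sum cg_mult cg_star VU i j) (simp_all add: fsV)
  also note UUs[OF i j]
  finally show "(\<Sum>k\<in>idx ns. pmult (V i k) (pstar (V j k))) \<approx> (if i = j then pone else 0)" .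
  have "(\<Sum>k\<in>idx ns. pmult (pstar (V k i)) (V k j)) \<approx> (\<Sum>k\<in>idx ns. pmult (pstar (U k i)) (U k j))"
    by (intro cg_sum cg_mult cg_star VU i j) (simp_all add: fsV)
  also note UsU[OF i j]
  finally show "(\<Sum>k\<in>idx ns. pmult (pstar (V k i)) (V k j)) \<approx> (if i = j then pone else 0)" .
  fix l assume l: "l \<in> idx ns"
  have "(\<Sum>p\<in>idx ns. \<Sum>q\<in>idx ns. psc (mc ns l p q) (pmult (V p i) (V q j)))
      \<approx> (\<Sum>p\<in>idx ns. \<Sum>q\<in>idx ns. psc (mc ns l p q) (pmult (U p i) (U q j)))"
    by (intro cg_sum cg_psc cg_mult VU i j) (simp_all add: fsV)
  also note Um[OF l i j]
  also have "(\<Sum>r\<in>idx ns. psc (mc ns r i j) (U l r)) \<approx> (\<Sum>r\<in>idx ns. psc (mc ns r i j) (V l r))"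
    by (intro cg_sum cg_psc UV l)
  finally show "(\<Sum>p\<in>idx ns. \<Sum>q\<in>idx ns. psc (mc ns l p q) (pmult (V p i) (V q j)))
      \<approx> (\<Sum>r\<in>idx ns. psc (mc ns r i j) (V l r))" .
next
  fix i assume i: "i \<in> idx ns"
  have "(\<Sum>j\<in>idx ns. psc (eta ns j) (V i j)) \<approx> (\<Sum>j\<in>idx ns. psc (eta ns j) (U i j))"
    by (intro cg_sum cg_psc cg_sym[OF UV] i)
  also note Ueta[OF i]
  finally show "(\<Sum>j\<in>idx ns. psc (eta ns j) (V i j)) \<approx> psc (eta ns i) pone" .
qed (simp_all add: fsV outV)

end

section \<open>The encoding graph\<close>

text \<open>\<open>As i\<close> has its rows in copy \<open>2 i + 1\<close> and its columns in copy
  \<open>2 i + 3\<close>, whence \<open>c div 2\<close>; the mirrored block is its adjoint.\<close>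

definition enc :: "(nat \<Rightarrow> mat) \<Rightarrow> nat \<Rightarrow> nat \<Rightarrow> mat" where
  "enc As c d =
    (if even c \<and> even d \<and> (c = d \<or> c = d + 2 \<or> d = c + 2) \<or> odd d \<and> c = Suc d \<or> odd c \<and> d = Suc c
     then mid
     else if odd c \<and> d = c + 2 then As (c div 2)
     else if odd d \<and> c = d + 2 then madj (As (d div 2))
     else (\<lambda>_ _. 0))"

text \<open>The operator \<open>T \<otimes> id\<close>, with l^2 of the copies read as C^N tensor
  l^2(X).\<close>

definition kron :: "nat list \<Rightarrow> (nat \<Rightarrow> nat \<Rightarrow> complex) \<Rightarrow> mat" where
  "kron ns T x y = (if bas ns x = bas ns y then T (cpy ns x) (cpy ns y) else 0)"

locale encoded = copied ns "2 * n + 3" + qut_rep I "copies (2 * n + 3) ns" U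
  for ns n and I :: "'g fpoly set" and U +
  fixes As :: "nat \<Rightarrow> mat"
  assumes comm_enc: "comm (blk ns (enc As))"
begin

abbreviation "N \<equiv> 2 * n + 3"

section \<open>Commuting scalar matrices between the copies\<close>

definition comm_kron :: "(nat \<Rightarrow> nat \<Rightarrow> complex) \<Rightarrow> bool" where
  "comm_kron T \<longleftrightarrow> comm (kron ns T)"

lemma comm_kron_cong: "comm_kron S \<Longrightarrow> (\<And>c d. c < N \<Longrightarrow> d < N \<Longrightarrow> S c d = T c d) \<Longrightarrow> comm_kron T"
  unfolding comm_kron_def by (erule comm_cong) (simp add: meq_def kron_def idx_copies)

lemma comm_kron_diff: "comm_kron S \<Longrightarrow> comm_kron T \<Longrightarrow> comm_kron (\<lambda>c d. S c d - T c d)"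
  unfolding comm_kron_def by (drule (1) comm_diff, erule comm_cong) (simp add: meq_def kron_def)

lemma comm_kron_mult:
  assumes "comm_kron S" "comm_kron T" shows "comm_kron (\<lambda>c d. \<Sum>e<N. S c e * T e d)"
proof -
  have "(\<Sum>z\<in>idx ns'. kron ns S x z * kron ns T z y) = kron ns (\<lambda>c d. \<Sum>e<N. S c e * T e d) x y"
    if "x \<in> idx ns'" "y \<in> idx ns'" for x y
  proof -
    have "(\<Sum>z\<in>idx ns'. kron ns S x z * kron ns T z y) = (\<Sum>e<N. \<Sum>i\<in>idx ns.
        if bas ns x = i then (if i = bas ns y then S (cpy ns x) e * T e (cpy ns y) else 0) else 0)"
      unfolding sum_copies by (intro sum.cong) (auto simp: kron_def)
    also have "\<dots> = kron ns (\<lambda>c d. \<Sum>e<N. S c e * T e d) x y"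
      using that by (simp add: kron_def)
    finally show ?thesis .
  qed
  with comm_mult[OF assms[unfolded comm_kron_def]] show ?thesis
    unfolding comm_kron_def by (elim comm_cong) (simp add: meq_def)
qed

lemma comm_kron_adj:
  assumes "comm_kron T" shows "comm_kron (\<lambda>c d. cnj (T d c))"
  using comm_madj[OF assms[unfolded comm_kron_def]] unfolding comm_kron_def
  by (rule comm_cong) (auto simp: meq_def kron_def madj_def)

lemma kron_diag: "kron ns (\<lambda>c d. if c = d \<and> p c then 1 else 0) x y
    = (if x = y \<and> p (cpy ns x) then 1 else 0)"
  using ix_eq_iff[of x y ns] by (auto simp: kron_def)

lemma kron_mid: "kron ns (\<lambda>c d. if c = d then 1 else 0) = mid"
  using kron_diag[of "\<lambda>_. True"] by (intro ext) (simp add: mid_def)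

text \<open>Projections multiplied from the left and the right cut out the rows with
  \<open>p\<close> and the columns with \<open>q\<close>.\<close>

lemma comm_cut:
  assumes p: "comm_kron (\<lambda>c d. if c = d \<and> p c then 1 else 0)" and q: "comm_kron (\<lambda>c d. if c = d \<and> q c then 1 else 0)"
    and A: "comm A"
  shows "comm (\<lambda>x y. if p (cpy ns x) \<and> q (cpy ns y) then A x y else 0)"
proof -
  have 1: "(\<Sum>z\<in>idx ns'. kron ns (\<lambda>c d. if c = d \<and> p c then 1 else 0) x z * B z)
      = (if p (cpy ns x) then B x else 0)" if "x \<in> idx ns'" for x B
  proof -
    have "(\<Sum>z\<in>idx ns'. kron ns (\<lambda>c d. if c = d \<and> p c then 1 else 0) x z * B z)
      = (\<Sum>z\<in>idx ns'. if z = x then (if p (cpy ns x) then B x else 0) else 0)"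
      by (intro sum.cong) (simp_all add: kron_diag)
    then show ?thesis using that by simp
  qed
  have 2: "(\<Sum>z\<in>idx ns'. B z * kron ns (\<lambda>c d. if c = d \<and> q c then 1 else 0) z y)
      = (if q (cpy ns y) then B y else 0)" if "y \<in> idx ns'" for y B
  proof -
    have "(\<Sum>z\<in>idx ns'. B z * kron ns (\<lambda>c d. if c = d \<and> q c then 1 else 0) z y)
      = (\<Sum>z\<in>idx ns'. if z = y then (if q (cpy ns y) then B y else 0) else 0)"
      by (intro sum.cong) (simp_all add: kron_diag)
    then show ?thesis using that by simp
  qed
  have "comm (\<lambda>x y. \<Sum>w\<in>idx ns'. kron ns (\<lambda>c d. if c = d \<and> p c then 1 else 0) x w
      * (\<Sum>z\<in>idx ns'. A w z * kron ns (\<lambda>c d. if c = d \<and> q c then 1 else 0) z y))"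
    using p q A unfolding comm_kron_def by (intro comm_mult)
  then show ?thesis
    by (rule comm_cong) (simp add: meq_def 1 2)
qed

section \<open>Matrix units and block-diagonality\<close>

abbreviation "ev \<equiv> \<lambda>c d :: nat. if c = d \<and> even c then 1 else 0 :: complex"

text \<open>Exactly the even copies carry loops, so Schur multiplication by the identity
  singles them out.\<close>

lemma comm_kron_even: "comm_kron ev"
proof -
  have "comm (bul ns' (blk ns (enc As)) (kron ns (\<lambda>c d. if c = d then 1 else 0)))"
    unfolding kron_mid by (intro comm_bul comm_enc comm_mid)
  moreover have "kron ns (\<lambda>c d. if c = d then 1 else 0)
      = blk ns (\<lambda>c d. if c = d then mid else (\<lambda>_ _. 0))"
    by (auto simp: kron_def blk_def mid_def fun_eq_iff)
  ultimately have "comm (bul ns' (blk ns (enc As)) (blk ns (\<lambda>c d. if c = d then mid else (\<lambda>_ _. 0))))"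
    by simp
  then show ?thesis
    unfolding comm_kron_def
    by (rule comm_cong) (auto simp: meq_def bul_blk enc_def bul_zero bul_mid_mid[OF qs] kron_def,
        auto simp: mid_def)
qed

lemma comm_kron_odd: "comm_kron (\<lambda>c d. if c = d \<and> odd c then 1 else 0)"
proof -
  have "comm_kron (\<lambda>c d. if c = d then 1 else 0)"
    by (simp add: comm_kron_def kron_mid comm_mid)
  from comm_kron_diff[OF this comm_kron_even] show ?thesis by (rule comm_kron_cong) auto
qed

text \<open>Partial isometry from each odd copy to its even successor: the part of the encoding
  graph with even rows and odd columns.\<close>

abbreviation "hook \<equiv> \<lambda>c d :: nat. if odd d \<and> c = Suc d then 1 else 0 :: complex"

lemma comm_kron_hook: "comm_kron hook"
proof -
  have "comm (\<lambda>x y. if even (cpy ns x) \<and> odd (cpy ns y) then blk ns (enc As) x y else 0)"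
    by (rule comm_cut[OF comm_kron_even comm_kron_odd comm_enc])
  then show ?thesis
    unfolding comm_kron_def
    by (rule comm_cong) (auto simp: meq_def kron_def blk_def enc_def mid_def)
qed

text \<open>Adjacency matrix of the path through the even copies: the even part of the encoding
  graph without its loops.\<close>

abbreviation "walk \<equiv> \<lambda>c d :: nat. if even c \<and> even d \<and> (c = d + 2 \<or> d = c + 2) then 1 else 0 :: complex"

lemma comm_kron_walk: "comm_kron walk"
proof -
  have "comm (\<lambda>x y. if even (cpy ns x) \<and> even (cpy ns y) then blk ns (enc As) x y else 0)"
    by (rule comm_cut[OF comm_kron_even comm_kron_even comm_enc])
  from comm_diff[OF this comm_kron_even[unfolded comm_kron_def]] show ?thesis
    unfolding comm_kron_def
    by (rule comm_cong) (auto simp: meq_def kron_def blk_def enc_def mid_def)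
qed

abbreviation "col \<equiv> \<lambda>a c d :: nat. if c = a \<and> d = 0 then 1 else 0 :: complex"

text \<open>\<open>col a\<close> is a matrix unit, so multiplying by it moves column
  \<open>a\<close> of \<open>S\<close> to column 0 and erases the rest.\<close>

lemma comm_kron_mult_col:
  assumes "comm_kron S" "comm_kron (col a)" "a < N" shows "comm_kron (\<lambda>c d. if d = 0 then S c a else 0)"
proof -
  have "(\<Sum>e<N. S c e * col a e d) = (if d = 0 then S c a else 0)" for c d
  proof -
    have "(\<Sum>e<N. S c e * col a e d) = (\<Sum>e<N. if e = a then (if d = 0 then S c a else 0) else 0)"
      by (intro sum.cong) auto
    then show ?thesis using assms(3) by simp
  qed
  then show ?thesis using comm_kron_mult[OF assms(1,2)] by simp
qed

text \<open>Copy 0 is the only even copy not attached to an odd one.\<close>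

lemma comm_kron_col0: "comm_kron (col 0)"
proof -
  have "(\<Sum>e<N. hook c e * cnj (hook d e)) = (if c = d \<and> even c \<and> 0 < c then 1 else 0)"
    if "c < N" for c d
  proof -
    \<comment> \<open>Only \<open>c - 1\<close> is hooked to \<open>c\<close>. For
      \<open>c = 0\<close> truncation gives \<open>c - 1 = 0\<close>, where the summand is 0 as
      well.\<close>
    have "(\<Sum>e<N. hook c e * cnj (hook d e))
        = (\<Sum>e<N. if e = c - 1 then (if c = d \<and> even c \<and> 0 < c then 1 else 0) else 0)"
      by (intro sum.cong) auto
    then show ?thesis using that by auto
  qed
  with comm_kron_mult[OF comm_kron_hook comm_kron_adj[OF comm_kron_hook]]
  have "comm_kron (\<lambda>c d. if c = d \<and> even c \<and> 0 < c then 1 else 0)"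
    by (rule comm_kron_cong)
  from comm_kron_diff[OF comm_kron_even this] show ?thesis by (rule comm_kron_cong) auto
qed

text \<open>\<open>walk\<close> leads from copy \<open>2 b\<close> to \<open>2 b + 2\<close> and, if
  \<open>b > 0\<close>, also to \<open>2 b - 2\<close>. Subtracting the matrix unit of the latter
  isolates the former: a three-term recurrence, hence strong induction.\<close>

lemma comm_kron_col_even: "2 * a < N \<Longrightarrow> comm_kron (col (2 * a))"
proof (induction a rule: less_induct)
  case (less a)
  show ?case
  proof (cases a)
    case 0
    then show ?thesis using comm_kron_col0 by simp
  next
    case (Suc b)
    then have b: "comm_kron (\<lambda>c d. if d = 0 then walk c (2 * b) else 0)"
      using less by (intro comm_kron_mult_col comm_kron_walk) auto
    show ?thesis
    proof (cases b)
      case 0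
      from b show ?thesis by (rule comm_kron_cong) (auto simp: Suc 0)
    next
      case (Suc e)
      then have "comm_kron (col (2 * e))" using less \<open>a = Suc b\<close> by auto
      from comm_kron_diff[OF b this] show ?thesis
        by (rule comm_kron_cong) (auto simp: Suc \<open>a = Suc b\<close>)
    qed
  qed
qed

lemma comm_kron_col: "a < N \<Longrightarrow> comm_kron (col a)"
proof (cases "even a")
  case True
  then show "a < N \<Longrightarrow> ?thesis" using comm_kron_col_even by auto
next
  case False
  assume "a < N"
  \<comment> \<open>\<open>N\<close> is odd, so an odd \<open>a < N\<close> has
    \<open>a + 1 < N\<close>; the adjoint of \<open>hook\<close> then leads back from copy
    \<open>a + 1\<close> to \<open>a\<close>.\<close>
  with False have "2 * ((a + 1) div 2) < N" "2 * ((a + 1) div 2) = Suc a" by presburger+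
  with comm_kron_col_even have "comm_kron (col (Suc a))" "Suc a < N" by metis+
  from comm_kron_mult_col[OF comm_kron_adj[OF comm_kron_hook] this] show ?thesis
    by (rule comm_kron_cong) (use False in auto)
qed

text \<open>In \<open>U (E \<otimes> id) = (E \<otimes> id) U\<close>, with \<open>E\<close> the
  matrix unit \<open>col a\<close>, the blocks with rows in copy \<open>c\<close> and columns in
  copy 0 are compared: block (c, a) of \<open>U\<close> on the left; block (0, 0) if
  \<open>c = a\<close>, else 0, on the right.\<close>

lemma U_diag:
  assumes i: "i \<in> idx ns" and j: "j \<in> idx ns" and a: "a < N" and c: "c < N"
  shows "U (emb ns c i) (emb ns a j) \<approx> (if c = a then U (emb ns 0 i) (emb ns 0 j) else 0)"
proof -
  let ?x = "emb ns c i" and ?y = "emb ns 0 j"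
  have xy: "?x \<in> idx ns'" "?y \<in> idx ns'" using i j c by auto
  have "(\<Sum>k\<in>idx ns'. psc (kron ns (col a) k ?y) (U ?x k))
      = (\<Sum>k\<in>idx ns'. if k = emb ns a j then U ?x (emb ns a j) else 0)"
  proof (rule sum.cong)
    fix k
    show "psc (kron ns (col a) k ?y) (U ?x k) = (if k = emb ns a j then U ?x (emb ns a j) else 0)"
      using j ix_eq_iff[of k "emb ns a j" ns]
      by (cases "k = emb ns a j") (auto simp: kron_def)
  qed simp
  also have "\<dots> = U ?x (emb ns a j)"
    using j a by simp
  finally have 1: "(\<Sum>k\<in>idx ns'. psc (kron ns (col a) k ?y) (U ?x k)) = U ?x (emb ns a j)" .
  have "(\<Sum>k\<in>idx ns'. psc (kron ns (col a) ?x k) (U k ?y))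
      = (\<Sum>k\<in>idx ns'. if k = emb ns 0 i then (if c = a then U (emb ns 0 i) ?y else 0) else 0)"
  proof (rule sum.cong)
    fix k
    show "psc (kron ns (col a) ?x k) (U k ?y)
        = (if k = emb ns 0 i then (if c = a then U (emb ns 0 i) ?y else 0) else 0)"
      using i ix_eq_iff[of k "emb ns 0 i" ns]
      by (cases "k = emb ns 0 i") (auto simp: kron_def)
  qed simp
  also have "\<dots> = (if c = a then U (emb ns 0 i) ?y else 0)"
    using i by simp
  finally have 2: "(\<Sum>k\<in>idx ns'. psc (kron ns (col a) ?x k) (U k ?y)) = (if c = a then U (emb ns 0 i) ?y else 0)" .
  show ?thesis
    using comm_kron_col[OF a, unfolded comm_kron_def comm_iff, rule_format, OF xy] unfolding 1 2 .
qed

definition corner :: "ix \<Rightarrow> ix \<Rightarrow> 'g fpoly" where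
  "corner i j = (if i \<in> idx ns \<and> j \<in> idx ns then U (emb ns 0 i) (emb ns 0 j) else 0)"

lemma U_cong_diag:
  assumes "x \<in> idx ns'" "y \<in> idx ns'"
  shows "U x y \<approx> diag ns ns' corner x y"
proof -
  have "bas ns x \<in> idx ns" "bas ns y \<in> idx ns" "cpy ns y < N" "cpy ns x < N"
    using assms by (simp_all add: idx_copies)
  from U_diag[OF this] show ?thesis
    using assms by (simp only: emb_cpy_bas diag_def corner_def bas_idx simp_thms if_True cong: if_cong)
qed

sublocale corner: copied_sideal ns N I corner
  by unfold_locales (auto simp: corner_def zero_mem)

text \<open>\<open>U\<close> is congruent to the direct sum of copies of \<open>corner\<close>; the
  relations pass to that sum and from there to the summand.\<close>

lemma corner_rep: "qut_rep I ns corner"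
  using rep_cong[OF corner.fsupp_diag U_cong_diag corner.out_diag] corner.diag_rep_iff by simp

lemma corner_comm:
  assumes "c < N" "d < N" shows "qut_rep.comm I ns corner (enc As c d)"
proof -
  have "qut_rep.comm I ns' (diag ns ns' corner) (blk ns (enc As))"
    using comm_rep_cong[OF U_cong_diag _ comm_enc] corner.diag_rep_iff corner_rep
    by simp
  then show ?thesis
    using assms corner.diag_comm_iff[OF corner_rep] by simp
qed

end

section \<open>Presentations and isomorphism\<close>

lemma fsupp_qut_rels: "r \<in> qut_rels ns X \<Longrightarrow> fsupp r"
  unfolding qut_rels_def qut_base_def qut_comm_def by auto

text \<open>The universal property, in the form that turns every check of relations into a statement
  about \<open>qut_rep\<close> and \<open>comm\<close>.\<close>

lemma qut_rels_iff:
  assumes "sideal I" and f: "\<And>x. fsupp (f x)"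
  shows "(\<forall>r\<in>qut_rels ns X. peval f r \<in> I) \<longleftrightarrow>
    qut_rep I ns (\<lambda>i j. f (i, j)) \<and> (\<forall>A\<in>X. qut_rep.comm I ns (\<lambda>i j. f (i, j)) A)"
proof -
  interpret sideal I by fact
  have 2: "(\<forall>r\<in>{g i j | i j. P i j}. Q r) \<longleftrightarrow> (\<forall>i j. P i j \<longrightarrow> Q (g i j))"
    for Q :: "(ix \<times> ix) fpoly \<Rightarrow> bool" and P and g :: "ix \<Rightarrow> ix \<Rightarrow> _"
    by blast
  have rep: "(\<forall>r\<in>qut_base ns. peval f r \<in> I) \<longleftrightarrow> qut_rep I ns (\<lambda>i j. f (i, j))"
  proof -
    have 1: "(\<forall>r\<in>{gen x | x. x \<notin> A}. Q r) \<longleftrightarrow> (\<forall>i j. (i, j) \<notin> A \<longrightarrow> Q (gen (i, j)))"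
      for Q :: "(ix \<times> ix) fpoly \<Rightarrow> bool" and A
      by fast
    have 3: "(\<forall>r\<in>{g l i j | l i j. P l i j}. Q r) \<longleftrightarrow> (\<forall>l i j. P l i j \<longrightarrow> Q (g l i j))"
      for Q :: "(ix \<times> ix) fpoly \<Rightarrow> bool" and P and g :: "ix \<Rightarrow> ix \<Rightarrow> ix \<Rightarrow> _"
      by blast
    have 4: "(\<forall>r\<in>{g i | i. P i}. Q r) \<longleftrightarrow> (\<forall>i. P i \<longrightarrow> Q (g i))"
      for Q :: "(ix \<times> ix) fpoly \<Rightarrow> bool" and P and g :: "ix \<Rightarrow> _"
      by blast
    have if_pone: "peval f (if b then pone else 0) = (if b then pone else 0)"
      "fsupp (if b then pone else 0)" for b
      by auto
    show ?thesis
      unfolding qut_base_def ball_Un 1 2 3 4 qut_rep_def qut_rep_axioms_def cg_def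
      by (simp add: f assms(1) if_pone conj_assoc imp_conjL del: split_paired_All)
  qed
  have comm: "(\<forall>r\<in>qut_comm ns A. peval f r \<in> I) \<longleftrightarrow> qut_rep.comm I ns (\<lambda>i j. f (i, j)) A"
    if "qut_rep I ns (\<lambda>i j. f (i, j))" for A
    unfolding qut_rep.comm_iff[OF that] qut_comm_def 2 cg_def
    by (simp add: f Ball_def imp_conjL del: split_paired_All)
  show ?thesis
    unfolding qut_rels_def using rep comm by auto
qed

lemma peval_gen: "fsupp r \<Longrightarrow> peval gen r = r"
proof (induction rule: fsupp_induct)
  case (wrd c w)
  have "weval gen w = wrd w"
    by (induction "gen :: 'a \<Rightarrow> 'a fpoly" w rule: weval.induct) (auto simp: gen_def sgen_def pone_def)
  then show ?case by (simp add: peval_wrd)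
qed auto

text \<open>Identity substitution: generators modulo their own relations are the universal
  example.\<close>

lemma qut_rels_gen:
  "qut_rep (star_ideal (qut_rels ns X)) ns (\<lambda>i j. gen (i, j))"
  "A \<in> X \<Longrightarrow> qut_rep.comm (star_ideal (qut_rels ns X)) ns (\<lambda>i j. gen (i, j)) A"
proof -
  have "\<forall>r\<in>qut_rels ns X. peval gen r \<in> star_ideal (qut_rels ns X)"
    by (auto simp: peval_gen fsupp_qut_rels intro: star_ideal_base)
  then show "qut_rep (star_ideal (qut_rels ns X)) ns (\<lambda>i j. gen (i, j))"
    "A \<in> X \<Longrightarrow> qut_rep.comm (star_ideal (qut_rels ns X)) ns (\<lambda>i j. gen (i, j)) A"
    using qut_rels_iff[OF sideal_star_ideal, of gen ns X "qut_rels ns X"] by auto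
qed

text \<open>An odd \<open>c\<close> with \<open>c + 2 < 2 * n + 3\<close> has
  \<open>c div 2 < n\<close>, so no matrix beyond the given family enters.\<close>

lemma enc_cases:
  assumes "c < 2 * n + 3" "d < 2 * n + 3" "P mid" "P (\<lambda>_ _. 0)"
    "\<And>i. i < n \<Longrightarrow> P (As i)" "\<And>i. i < n \<Longrightarrow> P (madj (As i))"
  shows "P (enc As c d)"
  using assms by (auto simp: enc_def elim!: oddE)

theorem theorem5p4:
  fixes ns :: "nat list" and n :: nat and As :: "nat \<Rightarrow> mat"
  assumes "qset ns"
    and "\<forall>i<n. qgraph ns (As i) \<and> regular ns (As i) \<and> no_loops ns (As i)"
  shows "\<exists>ns' A'. qset ns' \<and> qgraph ns' A' \<and> undirected ns' A' \<and>
           cmqg_iso (idx ns) (qut_rels ns (As ` {..<n})) (idx ns') (qut_rels ns' {A'})"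
proof -
  interpret copied ns "2 * n + 3"
    using assms(1) by unfold_locales auto
  define A where "A = blk ns (enc As)"
  define R where "R = qut_rels ns (As ` {..<n})"
  define S where "S = qut_rels ns' {A}"
  have "qgraph ns (enc As c d)" if "c < 2 * n + 3" "d < 2 * n + 3" for c d
    using that
  proof (rule enc_cases)
    show "qgraph ns mid" "qgraph ns (\<lambda>_ _. 0)"
      using bul_mid_mid[OF assms(1)] by (auto simp: qgraph_def meq_def bul_zero) (auto simp: mbar_def)
    show "qgraph ns (madj (As i))" if "i < n" for i
    proof -
      have A: "bul ns (As i) (As i) k l = As i k l" "cnj (As i (invol k) (invol l)) = As i k l"
        if "k \<in> idx ns" "l \<in> idx ns" for k l
        using assms(2) that \<open>i < n\<close> by (auto simp: qgraph_def meq_def mbar_def simp del: split_paired_All)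
      \<comment> \<open>Relabelling both indices by \<open>invol\<close> commutes with
        transposition, so invariance under the bar passes to the adjoint.\<close>
      have "mbar (madj (As i)) k l = madj (As i) k l" if "k \<in> idx ns" "l \<in> idx ns" for k l
        using A(2)[OF that(2,1)] by (simp add: mbar_def madj_def flip: A(2)[OF that(2,1)])
      with A(1) show ?thesis
        unfolding qgraph_def bul_madj meq_def by (simp add: madj_def)
    qed
  qed (use assms(2) in auto)
  then have qA: "qgraph ns' A"
    by (auto simp: qgraph_def meq_def A_def bul_blk idx_copies) (auto simp: mbar_def blk_def)
  have "madj (enc As d c) = enc As c d" for c d
    by (auto simp: enc_def madj_def[of "\<lambda>_ _. 0"])
  then have "cnj (enc As d c j i) = enc As c d i j" for c d i j
    by (metis madj_def)
  then have uA: "undirected ns' A"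
    by (simp add: undirected_def meq_def A_def madj_def blk_def)
  interpret UR: qut_rep "star_ideal R" ns "\<lambda>i j. gen (i, j)"
    unfolding R_def by (rule qut_rels_gen)
  interpret US: qut_rep "star_ideal S" ns' "\<lambda>i j. gen (i, j)"
    unfolding S_def by (rule qut_rels_gen)
  interpret E: encoded ns n "star_ideal S" "\<lambda>i j. gen (i, j)" As
    by unfold_locales (simp add: S_def qut_rels_gen flip: A_def)
  interpret D: copied_sideal ns "2 * n + 3" "star_ideal R" "\<lambda>i j. gen (i, j)"
    by unfold_locales (auto intro: UR.out)

  \<comment> \<open>\<open>p\<close> reads the small generators as block (0, 0) of the big
    representation; \<open>q\<close> reads the big ones as a direct sum of copies of the small
    representation.\<close>
  define p where "p = (\<lambda>(i, j). E.corner i j)"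
  define q where "q = (\<lambda>(x, y). D.D x y)"
  have fsp: "fsupp (p z)" for z
    by (cases z) (simp add: p_def)
  have fsq: "fsupp (q z)" for z
    by (cases z) (simp add: q_def D.fsupp_diag)
  have pR: "\<forall>r\<in>R. peval p r \<in> star_ideal S"
    unfolding R_def
  proof (subst qut_rels_iff[OF sideal_star_ideal fsp], intro conjI ballI)
    show "qut_rep (star_ideal S) ns (\<lambda>i j. p (i, j))"
      using E.corner_rep by (simp add: p_def)
    fix B assume "B \<in> As ` {..<n}"
    then obtain i where "i < n" "B = As i" by auto
    \<comment> \<open>Both copies exist, since \<open>i < n\<close> gives
      \<open>2 i + 3 \<le> 2 n + 1\<close>.\<close>
    moreover have "enc As (2 * i + 1) (2 * i + 3) = As i"
      by (simp add: enc_def)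
    ultimately show "qut_rep.comm (star_ideal S) ns (\<lambda>i j. p (i, j)) B"
      using E.corner_comm[of "2 * i + 1" "2 * i + 3"] by (simp add: p_def)
  qed
  have qS: "\<forall>s\<in>S. peval q s \<in> star_ideal R"
    unfolding S_def
  proof (subst qut_rels_iff[OF sideal_star_ideal fsq], intro conjI ballI)
    show "qut_rep (star_ideal R) ns' (\<lambda>i j. q (i, j))"
      using D.diag_rep_iff UR.qut_rep_axioms by (simp add: q_def)
    have comm_As: "UR.comm (As i)" if "i < n" for i
      unfolding R_def by (rule qut_rels_gen) (use that in auto)
    have "UR.comm (enc As c d)" if "c < 2 * n + 3" "d < 2 * n + 3" for c d
      by (rule enc_cases[where P = UR.comm, OF that])
        (simp_all add: comm_As UR.comm_mid UR.comm_zero UR.comm_madj)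
    then have "qut_rep.comm (star_ideal R) ns' D.D A"
      using D.diag_comm_iff[OF UR.qut_rep_axioms, of "enc As"] unfolding A_def by blast
    then show "qut_rep.comm (star_ideal R) ns' (\<lambda>i j. q (i, j)) B" if "B \<in> {A}" for B
      using that by (simp add: q_def)
  qed
  \<comment> \<open>Even an equality: block (0, 0) of the direct sum is the small representation
    itself.\<close>
  have qp: "peval q (p z) - gen z \<in> star_ideal R" if "z \<in> idx ns \<times> idx ns" for z
    using that by (auto simp: p_def q_def E.corner_def D.diag_emb UR.zero_mem)
  \<comment> \<open>The composite puts copies of block (0, 0) on the diagonal, so this is where
    block-diagonality with equal blocks enters.\<close>
  have pq: "peval p (q z) - gen z \<in> star_ideal S" if "z \<in> idx ns' \<times> idx ns'" for z
  proof -
    obtain x y where z: "z = (x, y)" by (cases z)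
    have "peval p (q z) = diag ns ns' E.corner x y"
      by (simp add: z p_def q_def diag_def)
    moreover have "US.cg (gen (x, y)) (diag ns ns' E.corner x y)"
      using that by (intro E.U_cong_diag) (auto simp: z)
    ultimately show ?thesis
      using US.cg_sym by (simp add: US.cg_def z)
  qed
  \<comment> \<open>The middle index runs over all copies. Outside copy 0 the left factor lies in an
    off-diagonal block and vanishes, which leaves the matrix product of the corner.\<close>
  have comult: "peval (comult (idx ns')) (p (i, j))
      - (\<Sum>k\<in>idx ns. pmult (peval (\<lambda>g. gen (Inl g)) (p (i, k))) (peval (\<lambda>g. gen (Inr g)) (p (k, j))))
      \<in> star_ideal (tens_rels S)"
    if i: "i \<in> idx ns" and j: "j \<in> idx ns" for i j
  proof -
    interpret T: sideal "star_ideal (tens_rels S)" by (rule sideal_star_ideal)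
    let ?t = "\<lambda>c k. pmult (gen (Inl (emb ns 0 i, emb ns c k))) (gen (Inr (emb ns c k, emb ns 0 j)))"
    \<comment> \<open>The embedding into the left tensor leg respects the relations, so it carries
      vanishing entries of the big representation to vanishing ones.\<close>
    have Inl: "peval (\<lambda>g. gen (Inl g)) x \<in> star_ideal (tens_rels S)" if "x \<in> star_ideal S" for x
      using that
      by (rule peval_star_ideal[OF sideal_star_ideal, rotated 2])
        (auto simp: S_def fsupp_qut_rels tens_rels_def intro: star_ideal_base)
    have "T.cg (?t c k) (if c = 0 then ?t 0 k else 0)" if "c < 2 * n + 3" "k \<in> idx ns" for c k
    proof (cases "c = 0")
      case False
      then have "gen (emb ns 0 i, emb ns c k) \<in> star_ideal S"
        using E.U_diag[of i k c 0] i that by (simp add: US.zero_iff)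
      from T.right_mem[OF _ Inl[OF this]] show ?thesis
        using False by (simp add: T.zero_iff)
    qed simp
    then have "T.cg (\<Sum>c<2 * n + 3. \<Sum>k\<in>idx ns. ?t c k)
        (\<Sum>c<2 * n + 3. \<Sum>k\<in>idx ns. if c = 0 then ?t 0 k else 0)"
      by (intro T.cg_sum) auto
    also have "(\<Sum>c<2 * n + 3. \<Sum>k\<in>idx ns. if c = 0 then ?t 0 k else 0) = (\<Sum>k\<in>idx ns. ?t 0 k)"
      by (subst sum.swap) simp
    finally show ?thesis
      using i j by (simp add: T.cg_def p_def E.corner_def comult_def sum_copies cong: sum.cong)
  qed
  have "cmqg_iso (idx ns) R (idx ns') S"
    unfolding cmqg_iso_def using fsp fsq pR qS qp pq comult by blast
  then show ?thesis
    using qset_copies qA uA unfolding R_def S_def by blast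
qed

end
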